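(* Let $M\subset\mathbb{E}^3$ be an oriented surface and let $\gamma: I\to M$ be a unit speed curve with $(\kappa_g(s),\tau_g(s))\neq(0,0)$. Then the following conditions are equivalent. (i) $\gamma$ is a relatively normal-slant helix. (ii) The relatively normal-indicatrix of $\gamma$ is part of a circle in $\mathbb{S}^2$. (iii) The function $$\sigma_v(s)=\left(\frac{1}{(\kappa_g^2+\tau_g^2)^{3/2}}\Big(\tau_g'\kappa_g-\kappa_g'\tau_g-\kappa_n(\kappa_g^2+\tau_g^2)\Big)\right)(s)$$ is constant. (iv) There exists a unit vector $d$ such that $\left\langle d,\frac{D_r}{\|D_r\|}\right\rangle$ is constant. (v) The $\mathsf{V}$-direction curve of $\gamma$ is a general helix. (vi) The $D_r$-integral curve of $\gamma$ is a circular helix.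
   Context: $\mathbb{E}^3$ is Euclidean 3-space, $\mathbb{S}^2$ is its unit sphere, and $I\subset\mathbb{R}$ is an interval. For a unit speed curve $\gamma$ (with arc-length parameter $s$) on an oriented surface $M\subset\mathbb{E}^3$, the Darboux frame along $\gamma$ is $\{\mathsf{T},\mathsf{V},\mathsf{U}\}$, where $\mathsf{T}=\gamma'$ is the unit tangent vector field of $\gamma$, $\mathsf{U}$ is the unit normal vector field of $M$ restricted to $\gamma$, and $\mathsf{V}=\mathsf{U}\times\mathsf{T}$. The geodesic curvature $\kappa_g$, normal curvature $\kappa_n$ and geodesic torsion $\tau_g$ of $\gamma$ are given by $$\mathsf{T}'=\kappa_g\mathsf{V}+\kappa_n\mathsf{U},\quad \mathsf{V}'=-\kappa_g\mathsf{T}+\tau_g\mathsf{U},\quad \mathsf{U}'=-\kappa_n\mathsf{T}-\tau_g\mathsf{V}.$$ The curve $\gamma$ is called a relatively normal-slant helix if its vector field $\mathsf{V}$ makes a constant angle with a fixed direction, i.e. there exist a fixed unit vector $d$ and a constant angle $\theta$ such that $\langle\mathsf{V},d\rangle=\cos\theta$ along $\gamma$. The relatively normal-indicatrix of $\gamma$ is the curve $\gamma_v(s)=\mathsf{V}(s)$ which $\mathsf{V}$ draws on $\mathbb{S}^2$. The rectifying Darboux vector field along $\gamma$ is $D_r(s)=\tau_g(s)\mathsf{T}(s)+\kappa_g(s)\mathsf{U}(s)$. A curve $\overline{\gamma}$ lying on $M$ is called a $\mathsf{V}$-direction curve of $\gamma$ if it is the integral curve of the vector field $\mathsf{V}$;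 in other words, if $\overline{\gamma}$ is the $\mathsf{V}$-direction curve of $\gamma$, then $\overline{\gamma}'(s)=\mathsf{V}(s)$. The $D_r$-integral curve of $\gamma$ is the integral curve of $D_r$, i.e. the curve $\beta$ with $\beta'(s)=D_r(s)$. A general helix (generalized helix) is a space curve whose tangent vector makes a constant angle with a fixed direction. A circular helix is a space curve with constant curvature and constant torsion.
   Formalization: The V-direction curve is only required to satisfy β' = V, not to lie on M (it need not: take a small circle of a sphere), and a straight line, whose torsion is undefined, counts as a degenerate circular helix (the case σ_v = 0, e.g. plane curves). *)

theory Defs
  imports "HOL-Analysis.Analysis"
begin

section \<open>Smooth maps\<close>

text \<open>
  On an open subset of a Euclidean space, \<open>C_k\<close> is defined by iterating directional derivatives,
  which in finite dimension amounts to the usual notion. A map on an arbitrary subset is smooth if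
  near each point it extends to a smooth map on an open set of the ambient space; this one notion
  covers parametrizations, curves on an interval that may contain its end points, and maps on a
  surface.
\<close>

primrec Ck_on :: "nat \<Rightarrow> 'a::euclidean_space set \<Rightarrow> ('a \<Rightarrow> 'b::real_normed_vector) \<Rightarrow> bool" where
  "Ck_on 0 W f \<longleftrightarrow> continuous_on W f"
| "Ck_on (Suc k) W f \<longleftrightarrow>
     (\<forall>x\<in>W. f differentiable (at x)) \<and> (\<forall>v. Ck_on k W (\<lambda>x. frechet_derivative f (at x) v))"

definition smooth_on :: "'a::euclidean_space set \<Rightarrow> ('a \<Rightarrow> 'b::real_normed_vector) \<Rightarrow> bool" where
  "smooth_on S f \<longleftrightarrow>
     (\<forall>x\<in>S. \<exists>W F. open W \<and> x \<in> W \<and> (\<forall>k. Ck_on k W F) \<and> (\<forall>y\<in>S \<inter> W. F y = f y))"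

section \<open>Oriented surfaces in Euclidean 3-space\<close>

definition local_parametrization ::
  "(real^3) set \<Rightarrow> (real^2 \<Rightarrow> real^3) \<Rightarrow> (real^2) set \<Rightarrow> bool" where
  "local_parametrization M \<phi> U \<longleftrightarrow>
     open U \<and> smooth_on U \<phi> \<and>
     (\<forall>q\<in>U. inj (frechet_derivative \<phi> (at q))) \<and>
     (\<exists>W \<psi>. open W \<and> homeomorphism U (M \<inter> W) \<phi> \<psi>)"

definition regular_surface :: "(real^3) set \<Rightarrow> bool" where
  "regular_surface M \<longleftrightarrow> (\<forall>p\<in>M. \<exists>\<phi> U. local_parametrization M \<phi> U \<and> p \<in> \<phi> ` U)"

definition tangent_plane :: "(real^3) set \<Rightarrow> real^3 \<Rightarrow> (real^3) set" where
  "tangent_plane M p =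
     {v. \<exists>\<phi> U q h. local_parametrization M \<phi> U \<and> q \<in> U \<and> \<phi> q = p \<and>
          v = frechet_derivative \<phi> (at q) h}"

definition oriented_surface :: "(real^3) set \<Rightarrow> (real^3 \<Rightarrow> real^3) \<Rightarrow> bool" where
  "oriented_surface M N \<longleftrightarrow>
     regular_surface M \<and> smooth_on M N \<and>
     (\<forall>p\<in>M. norm (N p) = 1 \<and> (\<forall>v\<in>tangent_plane M p. N p \<bullet> v = 0))"

section \<open>Curves\<close>

text \<open>
  All derivatives of curves are taken within the parameter interval, so they are one-sided at an
  end point belonging to it.
\<close>

abbreviation curve_deriv :: "real set \<Rightarrow> (real \<Rightarrow> 'a::real_normed_vector) \<Rightarrow> real \<Rightarrow> 'a" where
  "curve_deriv I c s \<equiv> vector_derivative c (at s within I)"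

definition nondegenerate_interval :: "real set \<Rightarrow> bool" where
  "nondegenerate_interval I \<longleftrightarrow> is_interval I \<and> (\<exists>a\<in>I. \<exists>b\<in>I. a < b)"

definition unit_speed_curve_on :: "(real^3) set \<Rightarrow> real set \<Rightarrow> (real \<Rightarrow> real^3) \<Rightarrow> bool" where
  "unit_speed_curve_on M I \<gamma> \<longleftrightarrow>
     smooth_on I \<gamma> \<and> \<gamma> ` I \<subseteq> M \<and> (\<forall>s\<in>I. norm (curve_deriv I \<gamma> s) = 1)"

definition integral_curve :: "real set \<Rightarrow> (real \<Rightarrow> real^3) \<Rightarrow> (real \<Rightarrow> real^3) \<Rightarrow> bool" where
  "integral_curve I X \<beta> \<longleftrightarrow> (\<forall>s\<in>I. (\<beta> has_vector_derivative X s) (at s within I))"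

definition unit_tangent :: "real set \<Rightarrow> (real \<Rightarrow> real^3) \<Rightarrow> real \<Rightarrow> real^3" where
  "unit_tangent I c s = curve_deriv I c s /\<^sub>R norm (curve_deriv I c s)"

definition general_helix :: "real set \<Rightarrow> (real \<Rightarrow> real^3) \<Rightarrow> bool" where
  "general_helix I c \<longleftrightarrow> (\<exists>d \<theta>. norm d = 1 \<and> (\<forall>s\<in>I. unit_tangent I c s \<bullet> d = cos \<theta>))"

text \<open>
  Curvature and torsion of a regular curve that need not have unit speed. Torsion is not defined
  where the curvature vanishes; there the division by zero gives the value 0. So a straight line
  counts as a degenerate circular helix.
\<close>

definition curvature :: "real set \<Rightarrow> (real \<Rightarrow> real^3) \<Rightarrow> real \<Rightarrow> real" where
  "curvature I c s =
     (let c1 = curve_deriv I c; c2 = curve_deriv I c1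
      in norm (cross3 (c1 s) (c2 s)) / norm (c1 s) ^ 3)"

definition torsion :: "real set \<Rightarrow> (real \<Rightarrow> real^3) \<Rightarrow> real \<Rightarrow> real" where
  "torsion I c s =
     (let c1 = curve_deriv I c; c2 = curve_deriv I c1; c3 = curve_deriv I c2
      in (cross3 (c1 s) (c2 s) \<bullet> c3 s) / norm (cross3 (c1 s) (c2 s)) ^ 2)"

definition circular_helix :: "real set \<Rightarrow> (real \<Rightarrow> real^3) \<Rightarrow> bool" where
  "circular_helix I c \<longleftrightarrow> curvature I c constant_on I \<and> torsion I c constant_on I"

definition circle :: "(real^3) set \<Rightarrow> bool" where
  "circle C \<longleftrightarrow>
     (\<exists>c n r. norm n = 1 \<and> r > 0 \<and> C = {x. dist c x = r \<and> (x - c) \<bullet> n = 0})"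

section \<open>Darboux frame and curvatures\<close>

definition darboux_T :: "real set \<Rightarrow> (real \<Rightarrow> real^3) \<Rightarrow> real \<Rightarrow> real^3" where
  "darboux_T I \<gamma> s = curve_deriv I \<gamma> s"

definition darboux_U :: "(real^3 \<Rightarrow> real^3) \<Rightarrow> (real \<Rightarrow> real^3) \<Rightarrow> real \<Rightarrow> real^3" where
  "darboux_U N \<gamma> s = N (\<gamma> s)"

definition darboux_V :: "(real^3 \<Rightarrow> real^3) \<Rightarrow> real set \<Rightarrow> (real \<Rightarrow> real^3) \<Rightarrow> real \<Rightarrow> real^3" where
  "darboux_V N I \<gamma> s = cross3 (darboux_U N \<gamma> s) (darboux_T I \<gamma> s)"

text \<open>
  The curvatures are the coefficients in the Darboux equations, read off with respect to the
  orthonormal frame; lemma \<open>darboux_equations\<close> below proves these equations.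
\<close>

definition geodesic_curvature :: "(real^3 \<Rightarrow> real^3) \<Rightarrow> real set \<Rightarrow> (real \<Rightarrow> real^3) \<Rightarrow> real \<Rightarrow> real" where
  "geodesic_curvature N I \<gamma> s = curve_deriv I (darboux_T I \<gamma>) s \<bullet> darboux_V N I \<gamma> s"

definition normal_curvature :: "(real^3 \<Rightarrow> real^3) \<Rightarrow> real set \<Rightarrow> (real \<Rightarrow> real^3) \<Rightarrow> real \<Rightarrow> real" where
  "normal_curvature N I \<gamma> s = curve_deriv I (darboux_T I \<gamma>) s \<bullet> darboux_U N \<gamma> s"

definition geodesic_torsion :: "(real^3 \<Rightarrow> real^3) \<Rightarrow> real set \<Rightarrow> (real \<Rightarrow> real^3) \<Rightarrow> real \<Rightarrow> real" where
  "geodesic_torsion N I \<gamma> s = curve_deriv I (darboux_V N I \<gamma>) s \<bullet> darboux_U N \<gamma> s"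

definition rectifying_darboux ::
  "(real^3 \<Rightarrow> real^3) \<Rightarrow> real set \<Rightarrow> (real \<Rightarrow> real^3) \<Rightarrow> real \<Rightarrow> real^3" where
  "rectifying_darboux N I \<gamma> s =
     geodesic_torsion N I \<gamma> s *\<^sub>R darboux_T I \<gamma> s +
     geodesic_curvature N I \<gamma> s *\<^sub>R darboux_U N \<gamma> s"

definition sigma_v :: "(real^3 \<Rightarrow> real^3) \<Rightarrow> real set \<Rightarrow> (real \<Rightarrow> real^3) \<Rightarrow> real \<Rightarrow> real" where
  "sigma_v N I \<gamma> s =
     (let \<kappa>g = geodesic_curvature N I \<gamma>; \<kappa>n = normal_curvature N I \<gamma>; \<tau>g = geodesic_torsion N I \<gamma>
      in 1 / ((\<kappa>g s)\<^sup>2 + (\<tau>g s)\<^sup>2) powr (3/2) *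
         (curve_deriv I \<tau>g s * \<kappa>g s - curve_deriv I \<kappa>g s * \<tau>g s - \<kappa>n s * ((\<kappa>g s)\<^sup>2 + (\<tau>g s)\<^sup>2)))"

definition relatively_normal_slant_helix ::
  "(real^3 \<Rightarrow> real^3) \<Rightarrow> real set \<Rightarrow> (real \<Rightarrow> real^3) \<Rightarrow> bool" where
  "relatively_normal_slant_helix N I \<gamma> \<longleftrightarrow>
     (\<exists>d \<theta>. norm d = 1 \<and> (\<forall>s\<in>I. darboux_V N I \<gamma> s \<bullet> d = cos \<theta>))"

text \<open>
  Only \<open>\<beta>' = V\<close> is required of a V-direction curve: V is a field along \<open>\<gamma>\<close>, and its integral
  curves in general leave the surface.
\<close>

definition V_direction_curve ::
  "(real^3 \<Rightarrow> real^3) \<Rightarrow> real set \<Rightarrow> (real \<Rightarrow> real^3) \<Rightarrow> (real \<Rightarrow> real^3) \<Rightarrow> bool" where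
  "V_direction_curve N I \<gamma> \<beta> \<longleftrightarrow> integral_curve I (darboux_V N I \<gamma>) \<beta>"

definition Dr_integral_curve ::
  "(real^3 \<Rightarrow> real^3) \<Rightarrow> real set \<Rightarrow> (real \<Rightarrow> real^3) \<Rightarrow> (real \<Rightarrow> real^3) \<Rightarrow> bool" where
  "Dr_integral_curve N I \<gamma> \<beta> \<longleftrightarrow> integral_curve I (rectifying_darboux N I \<gamma>) \<beta>"

section \<open>The Darboux equations\<close>

lemma at_within_interval_neq_bot:
  assumes "nondegenerate_interval I" "s \<in> I"
  shows "at s within I \<noteq> bot"
proof -
  obtain a b where ab: "a \<in> I" "b \<in> I" "a < b" and iv: "is_interval I"
    using assms(1) unfolding nondegenerate_interval_def by blast
  have "s islimpt I"
    using connected_imp_perfect[OF is_interval_connected[OF iv]] assms(2) ab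
    by (metis less_irrefl singletonD)
  then show ?thesis by (simp add: trivial_limit_within)
qed

lemma smooth_on_differentiable:
  assumes "smooth_on S f" "x \<in> S"
  shows "f differentiable (at x within S)"
proof -
  obtain W F where W: "open W" "x \<in> W" "\<And>k. Ck_on k W F" and eq: "\<And>y. y \<in> S \<inter> W \<Longrightarrow> F y = f y"
    using assms unfolding smooth_on_def by meson
  have "F differentiable (at x)" using W(2) W(3)[of "Suc 0"] by auto
  then obtain F' where "(F has_derivative F') (at x within S)"
    unfolding differentiable_def using has_derivative_at_withinI by blast
  moreover obtain e where e: "e > 0" "ball x e \<subseteq> W"
    using W open_contains_ball by blast
  ultimately have "(f has_derivative F') (at x within S)"
    by (rule_tac has_derivative_transform_within[of F F' x S e f])
       (use assms(2) eq e in \<open>auto simp: subset_iff dist_commute\<close>)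
  then show ?thesis by (auto simp: differentiable_def)
qed

lemma smooth_on_curve_deriv_differentiable:
  fixes c :: "real \<Rightarrow> 'b::real_normed_vector"
  assumes "smooth_on I c" "nondegenerate_interval I" "s \<in> I"
  shows "curve_deriv I c differentiable (at s within I)"
proof -
  obtain W F where W: "open W" "s \<in> W" "\<And>k. Ck_on k W F" and eq: "\<And>y. y \<in> I \<inter> W \<Longrightarrow> F y = c y"
    using assms unfolding smooth_on_def by meson
  let ?G = "\<lambda>t. frechet_derivative F (at t) 1"
  have "?G differentiable (at s)" using W(2) W(3)[of "Suc (Suc 0)"] by auto
  then obtain G' where G': "(?G has_derivative G') (at s within I)"
    unfolding differentiable_def using has_derivative_at_withinI by blast
  obtain e where e: "e > 0" "ball s e \<subseteq> W" using W open_contains_ball by blast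
  have "?G t = curve_deriv I c t" if t: "t \<in> I" "dist t s < e" for t
  proof -
    have tW: "t \<in> W" using e t by (auto simp: subset_iff dist_commute)
    then have "F differentiable (at t)" using W(3)[of "Suc 0"] by auto
    then have "(F has_derivative frechet_derivative F (at t)) (at t)"
      by (simp add: frechet_derivative_works)
    then have d: "(F has_derivative frechet_derivative F (at t)) (at t within I)"
      by (rule has_derivative_at_withinI)
    have "frechet_derivative F (at t) = (\<lambda>x. x *\<^sub>R ?G t)"
    proof
      fix x
      show "frechet_derivative F (at t) x = x *\<^sub>R ?G t"
        using linear_scale[OF has_derivative_linear[OF d], of x 1] by simp
    qed
    then have "(F has_vector_derivative ?G t) (at t within I)"
      unfolding has_vector_derivative_def using d by simp
    moreover obtain e' where e': "e' > 0" "ball t e' \<subseteq> W" using W(1) tW open_contains_ball by blast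
    ultimately have "(c has_vector_derivative ?G t) (at t within I)"
      by (rule_tac has_vector_derivative_transform_within[of F "?G t" t I e' c])
         (use t eq e' in \<open>auto simp: subset_iff dist_commute\<close>)
    then show ?thesis
      by (rule vector_derivative_within[OF at_within_interval_neq_bot[OF assms(2) t(1)], symmetric])
  qed
  then have "(curve_deriv I c has_derivative G') (at s within I)"
    by (intro has_derivative_transform_within[OF G' e(1) assms(3)]) auto
  then show ?thesis by (auto simp: differentiable_def)
qed

lemma velocity_orthogonal_normal:
  assumes surf: "oriented_surface M N" and I: "nondegenerate_interval I"
    and curve: "unit_speed_curve_on M I \<gamma>" and s: "s \<in> I"
  shows "darboux_T I \<gamma> s \<bullet> darboux_U N \<gamma> s = 0"
proof -
  define v n where "v = darboux_T I \<gamma> s" and "n = N (\<gamma> s)"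
  have \<gamma>M: "\<gamma> t \<in> M" if "t \<in> I" for t
    using curve that unfolding unit_speed_curve_on_def by blast
  have "(\<gamma> has_vector_derivative v) (at s within I)"
    using curve smooth_on_differentiable[of I \<gamma> s] s
    by (auto simp: v_def darboux_T_def unit_speed_curve_on_def vector_derivative_works)
  then have dg: "(\<gamma> has_derivative (\<lambda>h. h *\<^sub>R v)) (at s within I)"
    by (simp add: has_vector_derivative_def)
  obtain \<phi> U where par: "local_parametrization M \<phi> U" and "\<gamma> s \<in> \<phi> ` U"
    using surf \<gamma>M[OF s] unfolding oriented_surface_def regular_surface_def by blast
  then obtain q where q: "q \<in> U" "\<phi> q = \<gamma> s" by auto
  define L where "L = frechet_derivative \<phi> (at q)"
  obtain W \<psi> where W: "open W" and hom: "homeomorphism U (M \<inter> W) \<phi> \<psi>"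
    using par unfolding local_parametrization_def by blast
  have "\<phi> differentiable (at q)"
    using par q smooth_on_differentiable[of U \<phi> q] at_within_open[of q U]
    unfolding local_parametrization_def by auto
  then have dphi: "(\<phi> has_derivative L) (at q)"
    unfolding L_def by (simp add: frechet_derivative_works)
  have "linear L" using dphi has_derivative_linear by blast
  moreover have "inj L" using par q unfolding local_parametrization_def L_def by blast
  ultimately obtain c where c: "c > 0" "\<And>h. c * norm h \<le> norm (L h)"
    using linear_inj_bounded_below_pos by metis
  have n1: "norm n = 1" and nL: "n \<bullet> L h = 0" for h
    using surf \<gamma>M[OF s] par q unfolding oriented_surface_def tangent_plane_def L_def n_def by blast+
  have "((\<lambda>t. \<gamma> t \<bullet> n) has_derivative (\<lambda>h. 0)) (at s within I)"
    unfolding has_derivative_within_alt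
  proof (intro conjI allI impI)
    fix e :: real assume e: "e > 0"
    define K where "K = norm v + 1"
    have K: "K > 0" unfolding K_def by (simp add: add_nonneg_pos)
    obtain d1 where d1: "d1 > 0" "\<And>t. t \<in> I \<Longrightarrow> norm (t - s) < d1 \<Longrightarrow>
        norm (\<gamma> t - \<gamma> s - (t - s) *\<^sub>R v) \<le> 1 * norm (t - s)"
      using dg unfolding has_derivative_within_alt by (metis zero_less_one)
    have lip: "norm (\<gamma> t - \<gamma> s) \<le> K * norm (t - s)" if "t \<in> I" "norm (t - s) < d1" for t
    proof -
      have "norm (\<gamma> t - \<gamma> s) \<le> norm (\<gamma> t - \<gamma> s - (t - s) *\<^sub>R v) + norm ((t - s) *\<^sub>R v)"
        by (metis diff_add_cancel norm_triangle_ineq)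
      also have "\<dots> \<le> norm (t - s) + norm (t - s) * norm v" using d1(2)[OF that] by simp
      finally show ?thesis by (simp add: K_def algebra_simps)
    qed
    define \<epsilon> where "\<epsilon> = min (c / 2) (e * c / (2 * K))"
    have \<epsilon>: "\<epsilon> > 0" "\<epsilon> \<le> c / 2" "\<epsilon> * (2 / c) * K \<le> e"
    proof -
      show "\<epsilon> > 0" "\<epsilon> \<le> c / 2" using c e K by (auto simp: \<epsilon>_def)
      have "\<epsilon> * ((2 / c) * K) \<le> e * c / (2 * K) * ((2 / c) * K)"
        using c K by (intro mult_right_mono) (auto simp: \<epsilon>_def)
      then show "\<epsilon> * (2 / c) * K \<le> e" using c K by (simp add: field_simps)
    qed
    obtain \<delta> where \<delta>: "\<delta> > 0" "\<And>y. norm (y - q) < \<delta> \<Longrightarrow>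
        norm (\<phi> y - \<phi> q - L (y - q)) \<le> \<epsilon> * norm (y - q)"
      using dphi \<epsilon>(1) unfolding has_derivative_at_alt by blast
    have pW: "\<gamma> s \<in> M \<inter> W" and \<psi>p: "\<psi> (\<gamma> s) = q"
      using hom q unfolding homeomorphism_def by auto
    have "continuous_on (M \<inter> W) \<psi>" using hom unfolding homeomorphism_def by blast
    then obtain \<eta> where \<eta>: "\<eta> > 0" "\<And>y. y \<in> M \<inter> W \<Longrightarrow> dist y (\<gamma> s) < \<eta> \<Longrightarrow> dist (\<psi> y) q < \<delta>"
      using pW \<delta>(1) \<psi>p unfolding continuous_on_iff by metis
    obtain \<rho> where \<rho>: "\<rho> > 0" "ball (\<gamma> s) \<rho> \<subseteq> W" using W pW open_contains_ball by blast
    define d where "d = min d1 (min \<eta> \<rho> / K)"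
    have "d > 0" using d1 \<eta> \<rho> K by (auto simp: d_def)
    moreover have "norm (\<gamma> t \<bullet> n - \<gamma> s \<bullet> n - 0) \<le> e * norm (t - s)"
      if t: "t \<in> I" "norm (t - s) < d" for t
    proof -
      have l: "norm (\<gamma> t - \<gamma> s) \<le> K * norm (t - s)" using lip t by (simp add: d_def)
      have "norm (t - s) < min \<eta> \<rho> / K" using t(2) unfolding d_def by simp
      then have "K * norm (t - s) < min \<eta> \<rho>" using K by (simp add: field_simps)
      then have close: "dist (\<gamma> t) (\<gamma> s) < \<eta>" "dist (\<gamma> t) (\<gamma> s) < \<rho>"
        using l by (auto simp: dist_norm)
      then have tW: "\<gamma> t \<in> M \<inter> W" using \<rho> \<gamma>M[OF t(1)] by (auto simp: subset_iff dist_commute)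
      define h where "h = \<psi> (\<gamma> t) - q"
      have \<phi>\<psi>: "\<phi> (\<psi> (\<gamma> t)) = \<gamma> t" using hom tW unfolding homeomorphism_def by blast
      have "norm h < \<delta>" using \<eta>(2)[OF tW close(1)] by (simp add: h_def dist_norm)
      then have r: "norm (\<gamma> t - \<gamma> s - L h) \<le> \<epsilon> * norm h"
        using \<delta>(2)[of "\<psi> (\<gamma> t)"] q \<phi>\<psi> by (simp add: h_def)
      have "c * norm h \<le> norm (L h)" by (rule c(2))
      also have "\<dots> \<le> norm (\<gamma> t - \<gamma> s) + norm (\<gamma> t - \<gamma> s - L h)"
        using norm_triangle_ineq4[of "\<gamma> t - \<gamma> s" "\<gamma> t - \<gamma> s - L h"] by simp
      also have "\<dots> \<le> norm (\<gamma> t - \<gamma> s) + c / 2 * norm h"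
        using r mult_right_mono[OF \<epsilon>(2), of "norm h"] by simp
      finally have "norm h \<le> 2 / c * norm (\<gamma> t - \<gamma> s)" using c by (simp add: field_simps)
      also have "\<dots> \<le> 2 / c * (K * norm (t - s))" using l c by (intro mult_left_mono) auto
      finally have h: "norm h \<le> 2 / c * K * norm (t - s)" by (simp add: mult.assoc)
      have "\<gamma> t \<bullet> n - \<gamma> s \<bullet> n = (\<gamma> t - \<gamma> s - L h) \<bullet> n"
        using nL[of h] by (simp add: inner_diff_left inner_commute[of n])
      then have "norm (\<gamma> t \<bullet> n - \<gamma> s \<bullet> n - 0) \<le> norm (\<gamma> t - \<gamma> s - L h)"
        using Cauchy_Schwarz_ineq2[of "\<gamma> t - \<gamma> s - L h" n] n1 by simp
      also have "\<dots> \<le> \<epsilon> * (2 / c * K * norm (t - s))"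
        using r mult_left_mono[OF h, of \<epsilon>] \<epsilon>(1) by simp
      also have "\<dots> = (\<epsilon> * (2 / c) * K) * norm (t - s)" by (simp add: mult.assoc)
      also have "\<dots> \<le> e * norm (t - s)" using \<epsilon>(3) by (intro mult_right_mono) auto
      finally show ?thesis .
    qed
    ultimately show "\<exists>d>0. \<forall>t\<in>I. norm (t - s) < d \<longrightarrow>
        norm (\<gamma> t \<bullet> n - \<gamma> s \<bullet> n - 0) \<le> e * norm (t - s)" by blast
  qed simp
  then have "((\<lambda>t. \<gamma> t \<bullet> n) has_vector_derivative 0) (at s within I)"
    by (simp add: has_vector_derivative_def)
  moreover have "((\<lambda>t. \<gamma> t \<bullet> n) has_vector_derivative v \<bullet> n) (at s within I)"
    using has_derivative_inner_left[OF dg, of n] by (simp add: has_vector_derivative_def)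
  ultimately show ?thesis
    using vector_derivative_unique_within[OF at_within_interval_neq_bot[OF I s]]
    unfolding v_def n_def darboux_U_def by metis
qed

lemma cross3_frame_expansion:
  fixes t u w :: "real^3"
  assumes "norm t = 1" "norm u = 1" "t \<bullet> u = 0"
  shows "w = (w \<bullet> t) *\<^sub>R t + (w \<bullet> cross3 u t) *\<^sub>R cross3 u t + (w \<bullet> u) *\<^sub>R u"
proof -
  define v where "v = cross3 u t"
  define z where "z = w - ((w \<bullet> t) *\<^sub>R t + (w \<bullet> v) *\<^sub>R v + (w \<bullet> u) *\<^sub>R u)"
  have tt: "t \<bullet> t = 1" "u \<bullet> u = 1" "u \<bullet> t = 0" "t \<bullet> u = 0"
    using assms by (simp_all add: dot_square_norm inner_commute)
  have vtu: "v \<bullet> t = 0" "t \<bullet> v = 0" "v \<bullet> u = 0" "u \<bullet> v = 0"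
    unfolding v_def by (rule dot_cross_self)+
  have vv: "v \<bullet> v = 1"
    using norm_cross_dot[of u t] assms tt by (simp add: v_def dot_square_norm)
  then have nv: "norm v = 1" by (simp add: norm_eq_1)
  have z: "z \<bullet> t = 0" "z \<bullet> u = 0" "z \<bullet> v = 0"
    using tt vv vtu by (simp_all add: z_def inner_diff_left inner_add_left)
  have "cross3 z v = (z \<bullet> t) *\<^sub>R u - (z \<bullet> u) *\<^sub>R t" unfolding v_def by (rule Lagrange)
  then have "cross3 z v = 0" using z by simp
  then have "z = 0" using norm_cross_dot[of z v] z nv by simp
  then show ?thesis by (simp add: z_def v_def)
qed

lemma darboux_equations:
  assumes surf: "oriented_surface M N" and I: "nondegenerate_interval I"
    and curve: "unit_speed_curve_on M I \<gamma>" and s: "s \<in> I"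
  defines "T \<equiv> darboux_T I \<gamma>" and "V \<equiv> darboux_V N I \<gamma>" and "U \<equiv> darboux_U N \<gamma>"
    and "\<kappa>g \<equiv> geodesic_curvature N I \<gamma>" and "\<kappa>n \<equiv> normal_curvature N I \<gamma>"
    and "\<tau>g \<equiv> geodesic_torsion N I \<gamma>"
  shows "(T has_vector_derivative \<kappa>g s *\<^sub>R V s + \<kappa>n s *\<^sub>R U s) (at s within I)"
    and "(V has_vector_derivative - \<kappa>g s *\<^sub>R T s + \<tau>g s *\<^sub>R U s) (at s within I)"
    and "(U has_vector_derivative - \<kappa>n s *\<^sub>R T s - \<tau>g s *\<^sub>R V s) (at s within I)"
proof -
  let ?A = "at s within I"
  have nb: "?A \<noteq> bot" by (rule at_within_interval_neq_bot[OF I s])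
  have \<gamma>M: "\<gamma> ` I \<subseteq> M" using curve unfolding unit_speed_curve_on_def by blast
  have nT: "T t \<bullet> T t = 1" and nU: "U t \<bullet> U t = 1" and TU: "T t \<bullet> U t = 0" if "t \<in> I" for t
    using curve surf that \<gamma>M velocity_orthogonal_normal[OF surf I curve that]
    by (auto simp: T_def U_def darboux_T_def darboux_U_def unit_speed_curve_on_def
        oriented_surface_def dot_square_norm image_subset_iff)
  have V: "V t = cross3 (U t) (T t)" for t by (simp add: V_def U_def T_def darboux_V_def)
  have VT: "V t \<bullet> T t = 0" and VU: "V t \<bullet> U t = 0" for t
    by (auto simp: V dot_cross_self)
  have nV: "V t \<bullet> V t = 1" if "t \<in> I" for t
    using norm_cross_dot[of "U t" "T t"] nT[OF that] nU[OF that] TU[OF that]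
    by (simp add: V dot_square_norm inner_commute power_mult_distrib)
  have dT: "T differentiable ?A"
    using smooth_on_curve_deriv_differentiable[OF _ I s, of \<gamma>] curve
    by (simp add: T_def darboux_T_def[abs_def] unit_speed_curve_on_def)
  have dU: "U differentiable ?A"
  proof -
    have "N differentiable (at (\<gamma> s) within \<gamma> ` I)"
      using smooth_on_differentiable[of M N "\<gamma> s"] surf s \<gamma>M differentiable_within_subset
      unfolding oriented_surface_def by blast
    moreover have "\<gamma> differentiable ?A"
      using smooth_on_differentiable[of I \<gamma> s] curve s unfolding unit_speed_curve_on_def by blast
    ultimately show ?thesis
      unfolding U_def darboux_U_def[abs_def] using differentiable_chain_within[of \<gamma> s I N]
      by (simp add: o_def)
  qed
  define T' U' where "T' = vector_derivative T ?A" and "U' = vector_derivative U ?A"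
  have T': "(T has_vector_derivative T') ?A" and U': "(U has_vector_derivative U') ?A"
    using dT dU by (auto simp: T'_def U'_def vector_derivative_works)
  have bl: "bounded_bilinear cross3"
    using bilinear_cross bilinear_conv_bounded_bilinear by blast
  define V' where "V' = cross3 (U s) T' + cross3 U' (T s)"
  have V': "(V has_vector_derivative V') ?A"
    using bounded_bilinear.has_vector_derivative[OF bl U' T'] by (simp add: V'_def V[abs_def])
  have zero: "F s \<bullet> G' + F' \<bullet> G s = 0"
    if "(F has_vector_derivative F') ?A" "(G has_vector_derivative G') ?A" "\<And>t. t \<in> I \<Longrightarrow> F t \<bullet> G t = k"
    for F G :: "real \<Rightarrow> real^3" and F' G' k
  proof -
    have "((\<lambda>t. F t \<bullet> G t) has_vector_derivative F s \<bullet> G' + F' \<bullet> G s) ?A"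
      by (rule bounded_bilinear.has_vector_derivative[OF bounded_bilinear_inner that(1,2)])
    moreover have "((\<lambda>t. F t \<bullet> G t) has_vector_derivative 0) ?A"
      by (rule has_vector_derivative_transform[OF s that(3) has_vector_derivative_const])
    ultimately show ?thesis using vector_derivative_unique_within[OF nb] by metis
  qed
  have e: "w = (w \<bullet> T s) *\<^sub>R T s + (w \<bullet> V s) *\<^sub>R V s + (w \<bullet> U s) *\<^sub>R U s" for w
    using cross3_frame_expansion[of "T s" "U s" w] nT[OF s] nU[OF s] TU[OF s]
    by (simp add: V norm_eq_1)
  have k: "\<kappa>g s = T' \<bullet> V s" "\<kappa>n s = T' \<bullet> U s" "\<tau>g s = V' \<bullet> U s"
    using vector_derivative_within[OF nb V']
    by (simp_all add: \<kappa>g_def \<kappa>n_def \<tau>g_def geodesic_curvature_def normal_curvature_def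
        geodesic_torsion_def T'_def T_def U_def V_def)
  have z: "T' \<bullet> T s = 0" "V' \<bullet> V s = 0" "U' \<bullet> U s = 0" "V' \<bullet> T s = - \<kappa>g s"
    "U' \<bullet> T s = - \<kappa>n s" "U' \<bullet> V s = - \<tau>g s"
    using zero[OF T' T' nT] zero[OF V' V' nV] zero[OF U' U' nU] zero[OF V' T', of 0]
      zero[OF U' T', of 0] zero[OF U' V', of 0] VT VU TU
    by (simp_all add: k inner_commute)
  show "(T has_vector_derivative \<kappa>g s *\<^sub>R V s + \<kappa>n s *\<^sub>R U s) ?A"
    using T' e[of T'] z k by simp
  show "(V has_vector_derivative - \<kappa>g s *\<^sub>R T s + \<tau>g s *\<^sub>R U s) ?A"
    using V' e[of V'] z k by simp
  show "(U has_vector_derivative - \<kappa>n s *\<^sub>R T s - \<tau>g s *\<^sub>R V s) ?A"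
    using U' e[of U'] z k by simp
qed

end

theory Submission
  imports Defs
begin

text \<open>
  The theorem is Lancret's theorem for a curve with unit tangent \<open>V\<close>. Put \<open>\<omega> = sqrt (\<kappa>g\<^sup>2 + \<tau>g\<^sup>2)\<close>,
  which is positive by hypothesis, let \<open>E\<close> be the rectifying Darboux vector divided by its norm \<open>\<omega>\<close>,
  and let \<open>W = E \<times> V\<close>. The Darboux equations then become the structure equations
  \<open>V' = \<omega> W\<close>, \<open>W' = \<omega> (\<sigma> E - V)\<close>, \<open>E' = - \<omega> \<sigma> W\<close>, where \<open>\<sigma>\<close> is \<open>sigma_v\<close>: this is a Frenet frame
  for which \<open>\<sigma>\<close> is the ratio of torsion to curvature.

  If \<open>V \<bullet> d\<close> is constant then \<open>W \<bullet> d = 0\<close>, so \<open>E \<bullet> d\<close> is constant too, and one more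
  differentiation gives \<open>\<sigma> (E \<bullet> d) = V \<bullet> d\<close> with \<open>E \<bullet> d \<noteq> 0\<close>; hence \<open>\<sigma>\<close> is constant. Conversely, for
  constant \<open>\<sigma>\<close> the vector \<open>\<sigma> V + E\<close> is constant and serves as axis
  (\<open>V_slant_iff_\<sigma>_constant\<close>). Circles on the sphere are its sections by planes, which takes care of the
  indicatrix (\<open>V_slant_iff_circle\<close>). For the condition on \<open>E\<close> the delicate point is that \<open>\<sigma>\<close> may have zeros, where \<open>E' = 0\<close> for
  free; a constant \<open>E \<bullet> d\<close> still confines \<open>\<sigma>\<close> to finitely many values, and continuity finishes
  the argument (\<open>E_slant_iff_\<sigma>_constant\<close>).

  The unit tangent of a V-direction curve is \<open>V\<close> itself, so such a curve is a general helix exactly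
  when \<open>V\<close> makes a constant angle with a fixed direction. Writing \<open>D\<close> for the rectifying Darboux
  vector, the cross product of \<open>D\<close> and \<open>D'\<close> is
  \<open>\<omega> ^ 3 * \<sigma>\<close> times \<open>V\<close>, so an integral curve of \<open>D\<close> has curvature \<open>\<bar>\<sigma>\<bar>\<close> and torsion 1 where
  \<open>\<sigma>\<close> does not vanish (\<open>curvature_torsion_Dr_integral_curve\<close>). The conditions on integral curves also assert that
  these exist, which requires an antiderivative on an arbitrary interval
  (\<open>has_antiderivative_on_interval\<close>).

  These arguments differentiate the curvatures, which involve derivatives of the unit normal along
  the curve. Since smoothness of maps on a subset means local extendability, this rests on
  the chain rule for smooth maps (\<open>smooth_on_compose\<close>) and on the smoothness of derivatives of curves
  (\<open>smooth_on_curve_deriv\<close>).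
\<close>

section \<open>Calculus of smooth maps\<close>

lemma Ck_on_cong:
  assumes "open W" "\<And>x. x \<in> W \<Longrightarrow> f x = g x" "Ck_on k W f"
  shows "Ck_on k W g"
  using assms(2,3)
proof (induction k arbitrary: f g)
  case 0
  then show ?case by (simp cong: continuous_on_cong)
next
  case (Suc k)
  have "g differentiable (at x)"
    and "frechet_derivative f (at x) = frechet_derivative g (at x)" if x: "x \<in> W" for x
  proof -
    have f: "f differentiable (at x)" using Suc.prems(2) x by simp
    then show "frechet_derivative f (at x) = frechet_derivative g (at x)"
      using frechet_derivative_transform_within_open[OF _ assms(1) x] Suc.prems(1) by blast
    show "g differentiable (at x)"
      using f has_derivative_transform_within_open[OF _ assms(1) x] Suc.prems(1)
      unfolding differentiable_def by blast
  qed
  moreover have "Ck_on k W (\<lambda>x. frechet_derivative f (at x) v)" for v using Suc.prems(2) by simp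
  ultimately show ?case using Suc.IH[of "\<lambda>x. frechet_derivative f (at x) _"] by simp
qed

text \<open>
  The workhorse for closure properties: a derivative known in closed form replaces
  \<open>frechet_derivative\<close>, so that each induction step only has to inspect an explicit formula.
\<close>

lemma Ck_on_SucI:
  assumes "open W" "\<And>x. x \<in> W \<Longrightarrow> (f has_derivative D x) (at x)"
    and "\<And>v. Ck_on k W (\<lambda>x. D x v)"
  shows "Ck_on (Suc k) W f"
proof -
  have "D x = frechet_derivative f (at x)" if "x \<in> W" for x
    using frechet_derivative_at assms(2) that by blast
  then have "Ck_on k W (\<lambda>x. frechet_derivative f (at x) v)" for v
    using Ck_on_cong[OF assms(1) _ assms(3)[of v]] by simp
  then show ?thesis using assms(2) by (auto simp: differentiable_def)
qed

lemma Ck_on_has_derivative: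
  "Ck_on (Suc k) W f \<Longrightarrow> x \<in> W \<Longrightarrow> (f has_derivative frechet_derivative f (at x)) (at x)"
  by (simp add: frechet_derivative_works)

lemma Ck_on_subset: "Ck_on k W f \<Longrightarrow> X \<subseteq> W \<Longrightarrow> Ck_on k X f"
  by (induction k arbitrary: f) (auto intro: continuous_on_subset)

lemma Ck_on_SucD: "Ck_on (Suc k) W f \<Longrightarrow> Ck_on k W f"
proof (induction k arbitrary: f)
  case 0
  then show ?case
    by (auto intro!: continuous_at_imp_continuous_on differentiable_imp_continuous_within)
next
  case (Suc k)
  from Suc.prems have "\<forall>x\<in>W. f differentiable (at x)"
    and "\<And>v. Ck_on (Suc k) W (\<lambda>x. frechet_derivative f (at x) v)"
    unfolding Ck_on.simps(2)[of "Suc k"] by blast+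
  then show ?case using Suc.IH by (simp only: Ck_on.simps(2)[of k]) blast
qed

lemma Ck_on_const: "open W \<Longrightarrow> Ck_on k W (\<lambda>x. c)"
proof (induction k arbitrary: c)
  case (Suc k)
  then show ?case by (intro Ck_on_SucI[where D="\<lambda>_ _. 0"]) auto
qed simp

lemma Ck_on_add:
  assumes "open W" "Ck_on k W f" "Ck_on k W g"
  shows "Ck_on k W (\<lambda>x. f x + g x)"
  using assms(2,3)
proof (induction k arbitrary: f g)
  case 0
  then show ?case by (simp add: continuous_on_add)
next
  case (Suc k)
  have "((\<lambda>x. f x + g x) has_derivative
      (\<lambda>v. frechet_derivative f (at x) v + frechet_derivative g (at x) v)) (at x)" if "x \<in> W" for x
    by (intro has_derivative_add Ck_on_has_derivative[of k W] that Suc.prems)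
  then show ?case using Suc by (intro Ck_on_SucI[OF assms(1)]) auto
qed

lemma Ck_on_sum:
  "open W \<Longrightarrow> (\<And>i. i \<in> A \<Longrightarrow> Ck_on k W (f i)) \<Longrightarrow> Ck_on k W (\<lambda>x. \<Sum>i\<in>A. f i x)"
  by (induction A rule: infinite_finite_induct) (auto intro: Ck_on_const Ck_on_add)

text \<open>
  One product rule for scalar multiples, inner products and cross products. The Leibniz terms
  contain the undifferentiated factors, which is why \<open>Ck_on_SucD\<close> is needed.
\<close>

lemma Ck_on_bounded_bilinear:
  assumes B: "bounded_bilinear B" and W: "open W" and "Ck_on k W f" "Ck_on k W g"
  shows "Ck_on k W (\<lambda>x. B (f x) (g x))"
  using assms(3,4)
proof (induction k arbitrary: f g)
  case 0
  then show ?case by (simp add: bounded_bilinear.continuous_on[OF B])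
next
  case (Suc k)
  have "Ck_on k W f" "Ck_on k W g" using Suc.prems by (blast intro: Ck_on_SucD)+
  moreover have "((\<lambda>x. B (f x) (g x)) has_derivative
      (\<lambda>v. B (f x) (frechet_derivative g (at x) v) + B (frechet_derivative f (at x) v) (g x))) (at x)"
    if "x \<in> W" for x
    by (intro bounded_bilinear.FDERIV[OF B] Ck_on_has_derivative[of k W] that Suc.prems)
  ultimately show ?case
    using Suc by (intro Ck_on_SucI[OF W, where D="\<lambda>x v. B (f x) (frechet_derivative g (at x) v) + B (frechet_derivative f (at x) v) (g x)"] Ck_on_add W) auto
qed

text \<open>
  Expanding the inner derivative in the standard basis turns the chain rule into a sum of products
  of compositions, each with one derivative less; this is why the induction runs over all outer
  functions at once.
\<close>

lemma Ck_on_compose: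
  fixes g :: "'a::euclidean_space \<Rightarrow> 'b::euclidean_space"
  assumes W: "open W" and gX: "g ` W \<subseteq> X" and "Ck_on k W g" "Ck_on k X f"
  shows "Ck_on k W (\<lambda>x. f (g x))"
  using assms(3,4)
proof (induction k arbitrary: f)
  case 0
  then show ?case using gX by (auto intro: continuous_on_compose2)
next
  case (Suc k)
  let ?Dg = "\<lambda>x. frechet_derivative g (at x)" and ?Df = "\<lambda>y. frechet_derivative f (at y)"
  have gk: "Ck_on k W g" using Suc.prems(1) by (rule Ck_on_SucD)
  have "((\<lambda>x. f (g x)) has_derivative (\<lambda>v. \<Sum>b\<in>Basis. (?Dg x v \<bullet> b) *\<^sub>R ?Df (g x) b)) (at x)"
    if x: "x \<in> W" for x
  proof -
    have df: "(f has_derivative ?Df (g x)) (at (g x))"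
      using Ck_on_has_derivative[OF Suc.prems(2)] gX x by blast
    have "?Df (g x) w = (\<Sum>b\<in>Basis. (w \<bullet> b) *\<^sub>R ?Df (g x) b)" for w
      using linear_sum[OF has_derivative_linear[OF df], of "\<lambda>b. (w \<bullet> b) *\<^sub>R b" Basis]
      by (simp add: linear_scale[OF has_derivative_linear[OF df]] euclidean_representation)
    then have "(\<lambda>v. ?Df (g x) (?Dg x v)) = (\<lambda>v. \<Sum>b\<in>Basis. (?Dg x v \<bullet> b) *\<^sub>R ?Df (g x) b)"
      by (rule ext)
    with has_derivative_compose[OF Ck_on_has_derivative[OF Suc.prems(1) x] df]
    show ?thesis by (rule back_subst)
  qed
  moreover have "Ck_on k W (\<lambda>x. \<Sum>b\<in>Basis. (?Dg x v \<bullet> b) *\<^sub>R ?Df (g x) b)" for v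
  proof (intro Ck_on_sum W Ck_on_bounded_bilinear[OF bounded_bilinear_scaleR W])
    fix b :: 'b
    show "Ck_on k W (\<lambda>x. ?Dg x v \<bullet> b)"
      using Suc.prems(1) by (intro Ck_on_bounded_bilinear[OF bounded_bilinear_inner W] Ck_on_const W) simp
    show "Ck_on k W (\<lambda>x. ?Df (g x) b)" using Suc.prems(2) by (intro Suc.IH gk) simp
  qed
  ultimately show ?case by (rule Ck_on_SucI[OF W])
qed

lemma smooth_on_extension:
  assumes "smooth_on S f" "x \<in> S"
  obtains W F where "open W" "x \<in> W" "\<And>k. Ck_on k W F" "\<And>y. y \<in> S \<inter> W \<Longrightarrow> F y = f y"
  using assms unfolding smooth_on_def by meson

lemma smooth_on_bounded_bilinear:
  assumes B: "bounded_bilinear B" and f: "smooth_on S f" and g: "smooth_on S g"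
  shows "smooth_on S (\<lambda>x. B (f x) (g x))"
  unfolding smooth_on_def
proof
  fix x assume x: "x \<in> S"
  obtain W F where W: "open W" "x \<in> W" "\<And>k. Ck_on k W F" "\<And>y. y \<in> S \<inter> W \<Longrightarrow> F y = f y"
    using smooth_on_extension[OF f x] by blast
  obtain X G where X: "open X" "x \<in> X" "\<And>k. Ck_on k X G" "\<And>y. y \<in> S \<inter> X \<Longrightarrow> G y = g y"
    using smooth_on_extension[OF g x] by blast
  have "Ck_on k (W \<inter> X) (\<lambda>y. B (F y) (G y))" for k
    using W X by (intro Ck_on_bounded_bilinear[OF B] open_Int) (auto intro: Ck_on_subset)
  then show "\<exists>W F. open W \<and> x \<in> W \<and> (\<forall>k. Ck_on k W F) \<and> (\<forall>y\<in>S \<inter> W. F y = B (f y) (g y))"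
    using W X by (intro exI[of _ "W \<inter> X"] exI[of _ "\<lambda>y. B (F y) (G y)"]) auto
qed

lemma smooth_on_add:
  assumes f: "smooth_on S f" and g: "smooth_on S g"
  shows "smooth_on S (\<lambda>x. f x + g x)"
  unfolding smooth_on_def
proof
  fix x assume x: "x \<in> S"
  obtain W F where W: "open W" "x \<in> W" "\<And>k. Ck_on k W F" "\<And>y. y \<in> S \<inter> W \<Longrightarrow> F y = f y"
    using smooth_on_extension[OF f x] by blast
  obtain X G where X: "open X" "x \<in> X" "\<And>k. Ck_on k X G" "\<And>y. y \<in> S \<inter> X \<Longrightarrow> G y = g y"
    using smooth_on_extension[OF g x] by blast
  have "Ck_on k (W \<inter> X) (\<lambda>y. F y + G y)" for k
    using W X by (intro Ck_on_add open_Int) (auto intro: Ck_on_subset)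
  then show "\<exists>W F. open W \<and> x \<in> W \<and> (\<forall>k. Ck_on k W F) \<and> (\<forall>y\<in>S \<inter> W. F y = f y + g y)"
    using W X by (intro exI[of _ "W \<inter> X"] exI[of _ "\<lambda>y. F y + G y"]) auto
qed

lemma smooth_on_compose:
  fixes c :: "'a::euclidean_space \<Rightarrow> 'b::euclidean_space"
  assumes c: "smooth_on S c" and f: "smooth_on M f" and cM: "c ` S \<subseteq> M"
  shows "smooth_on S (\<lambda>x. f (c x))"
  unfolding smooth_on_def
proof
  fix x assume x: "x \<in> S"
  obtain W C where W: "open W" "x \<in> W" "\<And>k. Ck_on k W C" "\<And>y. y \<in> S \<inter> W \<Longrightarrow> C y = c y"
    using smooth_on_extension[OF c x] by blast
  obtain X F where X: "open X" "c x \<in> X" "\<And>k. Ck_on k X F" "\<And>y. y \<in> M \<inter> X \<Longrightarrow> F y = f y"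
    using smooth_on_extension[OF f, of "c x"] x cM by blast
  define Y where "Y = W \<inter> C -` X"
  have "continuous_on W C" using W(3)[of 0] by simp
  then have Y: "open Y" unfolding Y_def using W(1) X(1) by (simp add: continuous_on_open_vimage Int_commute)
  moreover have "Ck_on k Y (\<lambda>y. F (C y))" for k
    by (rule Ck_on_compose[OF Y _ Ck_on_subset[OF W(3)] X(3)]) (auto simp: Y_def)
  ultimately show "\<exists>W F. open W \<and> x \<in> W \<and> (\<forall>k. Ck_on k W F) \<and> (\<forall>y\<in>S \<inter> W. F y = f (c y))"
    using W X x cM by (intro exI[of _ Y] exI[of _ "\<lambda>y. F (C y)"]) (auto simp: Y_def image_subset_iff)
qed

lemma smooth_on_curve_deriv:
  fixes c :: "real \<Rightarrow> 'b::real_normed_vector"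
  assumes c: "smooth_on I c" and I: "nondegenerate_interval I"
  shows "smooth_on I (curve_deriv I c)"
  unfolding smooth_on_def
proof
  fix s assume s: "s \<in> I"
  obtain W F where W: "open W" "s \<in> W" "\<And>k. Ck_on k W F" "\<And>y. y \<in> I \<inter> W \<Longrightarrow> F y = c y"
    using smooth_on_extension[OF c s] by blast
  have "frechet_derivative F (at t) 1 = curve_deriv I c t" if t: "t \<in> I \<inter> W" for t
  proof -
    have "F differentiable (at t)" using W(3)[of "Suc 0"] t by simp
    then have "(F has_vector_derivative frechet_derivative F (at t) 1) (at t)"
      by (metis frechet_derivative_at frechet_derivative_works has_vector_derivative_def scaleR_one
          vector_derivative_works)
    then have d: "(F has_vector_derivative frechet_derivative F (at t) 1) (at t within I)"
      by (rule has_vector_derivative_at_within)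
    obtain e where e: "e > 0" "ball t e \<subseteq> W" using W(1) t open_contains_ball by blast
    have "(c has_vector_derivative frechet_derivative F (at t) 1) (at t within I)"
      by (rule has_vector_derivative_transform_within[OF d e(1)])
         (use t W(4) e(2) in \<open>auto simp: subset_iff dist_commute\<close>)
    then show ?thesis
      by (rule vector_derivative_within[OF at_within_interval_neq_bot[OF I IntD1[OF t]], symmetric])
  qed
  moreover have "Ck_on k W (\<lambda>t. frechet_derivative F (at t) 1)" for k using W(3)[of "Suc k"] by simp
  ultimately show "\<exists>W F. open W \<and> s \<in> W \<and> (\<forall>k. Ck_on k W F) \<and> (\<forall>y\<in>I \<inter> W. F y = curve_deriv I c y)"
    using W by (intro exI[of _ W] exI[of _ "\<lambda>t. frechet_derivative F (at t) 1"]) auto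
qed

section \<open>Curves on an interval\<close>

lemma nondegenerate_interval_nonempty: "nondegenerate_interval I \<Longrightarrow> I \<noteq> {}"
  unfolding nondegenerate_interval_def by blast

lemma smooth_on_has_curve_deriv:
  "smooth_on I c \<Longrightarrow> s \<in> I \<Longrightarrow> (c has_vector_derivative curve_deriv I c s) (at s within I)"
  using smooth_on_differentiable vector_derivative_works by blast

lemma smooth_on_imp_continuous_on: "smooth_on I c \<Longrightarrow> continuous_on I c"
  by (simp add: continuous_on_eq_continuous_within differentiable_imp_continuous_within
      smooth_on_differentiable)

text \<open>
  The interval need not be closed or bounded, so the fundamental theorem of calculus on compact
  intervals is applied locally: one signed integral from a fixed base point serves on every compact
  subinterval through that point, and every point of the interval has a relative neighbourhood
  inside such a subinterval.
\<close>

lemma has_antiderivative_on_interval: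
  fixes X :: "real \<Rightarrow> 'a::banach"
  assumes I: "is_interval I" and X: "continuous_on I X"
  obtains \<beta> where "\<And>s. s \<in> I \<Longrightarrow> (\<beta> has_vector_derivative X s) (at s within I)"
proof (cases "I = {}")
  case False
  then obtain a where a: "a \<in> I" by blast
  define \<beta> where "\<beta> s = integral {a..s} X - integral {s..a} X" for s
  have "(\<beta> has_vector_derivative X s) (at s within I)" if s: "s \<in> I" for s
  proof -
    \<comment> \<open>A compact subinterval containing the base point and a neighbourhood of \<open>s\<close> in \<open>I\<close>.\<close>
    obtain p where p: "p \<in> I" "p \<le> a" "p \<le> s" "p < s \<or> (\<forall>t\<in>I. s \<le> t)"
    proof (cases "\<forall>t\<in>I. s \<le> t")
      case True
      then show ?thesis by (intro that[of s]) (use s a in auto)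
    next
      case False
      then obtain t where "t \<in> I" "t < s" by force
      then show ?thesis by (intro that[of "min t a"]) (use a in \<open>auto simp: min_def\<close>)
    qed
    obtain q where q: "q \<in> I" "a \<le> q" "s \<le> q" "s < q \<or> (\<forall>t\<in>I. t \<le> s)"
    proof (cases "\<forall>t\<in>I. t \<le> s")
      case True
      then show ?thesis by (intro that[of s]) (use s a in auto)
    next
      case False
      then obtain t where "t \<in> I" "s < t" by force
      then show ?thesis by (intro that[of "max t a"]) (use a in \<open>auto simp: max_def\<close>)
    qed
    have pq: "{p..q} \<subseteq> I" using mem_is_interval_1_I[OF I p(1) q(1)] by auto
    have int: "X integrable_on {u..v}" if "p \<le> u" "v \<le> q" for u v
      using that pq by (intro integrable_continuous_interval continuous_on_subset[OF X]) auto
    have \<beta>: "integral {p..t} X - integral {p..a} X = \<beta> t" if t: "t \<in> {p..q}" for t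
    proof (cases "a \<le> t")
      case True
      then have "integral {p..a} X + integral {a..t} X = integral {p..t} X"
        using p t by (intro Henstock_Kurzweil_Integration.integral_combine int) auto
      moreover have "integral {t..a} X = 0" using True by (cases "a = t") auto
      ultimately show ?thesis by (simp add: \<beta>_def algebra_simps)
    next
      case False
      then have "integral {p..t} X + integral {t..a} X = integral {p..a} X"
        using q t by (intro Henstock_Kurzweil_Integration.integral_combine int) auto
      then show ?thesis using False by (simp add: \<beta>_def algebra_simps)
    qed
    have "((\<lambda>t. integral {p..t} X) has_vector_derivative X s) (at s within {p..q})"
      using p q pq by (intro integral_has_vector_derivative continuous_on_subset[OF X]) auto
    then have "((\<lambda>t. integral {p..t} X - integral {p..a} X) has_vector_derivative X s - 0)
        (at s within {p..q})"
      by (intro has_vector_derivative_diff has_vector_derivative_const)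
    then have "((\<lambda>t. integral {p..t} X - integral {p..a} X) has_vector_derivative X s)
        (at s within {p..q})" by simp
    then have "(\<beta> has_vector_derivative X s) (at s within {p..q})"
      by (rule has_vector_derivative_transform[OF _ \<beta>[symmetric], rotated -1]) (use p q in auto)
    moreover have "at s within I = at s within {p..q}"
    proof (rule at_within_nhd)
      define l where "l = (if p < s then p else s - 1)"
      define r where "r = (if s < q then q else s + 1)"
      show "s \<in> {l<..<r}" "open {l<..<r}" by (auto simp: l_def r_def)
      show "I \<inter> {l<..<r} - {s} = {p..q} \<inter> {l<..<r} - {s}"
        using p q pq by (auto simp: l_def r_def split: if_splits intro!: order.antisym)
    qed
    ultimately show ?thesis by simp
  qed
  then show ?thesis using that by blast
qed (use that in auto)

lemma has_vector_derivative_0_constant_on: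
  assumes "nondegenerate_interval I"
    and "\<And>s. s \<in> I \<Longrightarrow> (f has_vector_derivative 0) (at s within I)"
  shows "f constant_on I"
  using has_vector_derivative_zero_constant[of I f] assms
  unfolding nondegenerate_interval_def constant_on_def is_interval_convex_1 by metis

text \<open>
  Constancy near the point suffices. This is needed for a direction making a constant angle
  with the rectifying Darboux vector: its inner product with the derivative of \<open>V\<close> is known to vanish only on a relatively open part of the
  interval.
\<close>

lemma locally_constant_has_vector_derivative:
  assumes I: "nondegenerate_interval I" and "(f has_vector_derivative y) (at s within I)" "s \<in> I"
    and "eventually (\<lambda>t. f t = c) (at s within I)" "f s = c"
  shows "y = 0"
proof -
  have "(f has_vector_derivative 0) (at s within I) \<longleftrightarrow> ((\<lambda>_. c) has_vector_derivative 0) (at s within I)"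
    by (rule has_vector_derivative_cong_ev)
       (use assms(4,5) in \<open>auto simp: eventually_at_filter elim: eventually_mono\<close>)
  then show ?thesis
    using vector_derivative_unique_within[OF at_within_interval_neq_bot[OF I assms(3)] assms(2)] by simp
qed

section \<open>Lancret's theorem for a moving frame\<close>

text \<open>
  The orthonormal frame \<open>V\<close>, \<open>E \<times> V\<close>, \<open>E\<close> with the structure equations of a Frenet frame: the
  assumptions on the derivatives of \<open>V\<close> and \<open>E\<close> determine that of \<open>E \<times> V\<close>. A curve with unit tangent
  \<open>V\<close> has curvature \<open>\<omega>\<close> and torsion \<open>\<omega> * \<sigma>\<close>, so \<open>\<sigma>\<close> is the ratio in Lancret's
  theorem. Only \<open>\<omega>\<close> has to be positive; \<open>\<sigma>\<close> may vanish, and its continuity is what controls its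
  zeros.
\<close>

locale moving_frame =
  fixes I :: "real set" and V E :: "real \<Rightarrow> real^3" and \<omega> \<sigma> :: "real \<Rightarrow> real"
  assumes interval: "nondegenerate_interval I"
    and norm_V: "s \<in> I \<Longrightarrow> norm (V s) = 1"
    and norm_E: "s \<in> I \<Longrightarrow> norm (E s) = 1"
    and V_orth_E: "s \<in> I \<Longrightarrow> V s \<bullet> E s = 0"
    and \<omega>_pos: "s \<in> I \<Longrightarrow> \<omega> s > 0"
    and deriv_V: "s \<in> I \<Longrightarrow>
      (V has_vector_derivative \<omega> s *\<^sub>R cross3 (E s) (V s)) (at s within I)"
    and deriv_E: "s \<in> I \<Longrightarrow>
      (E has_vector_derivative - (\<omega> s * \<sigma> s) *\<^sub>R cross3 (E s) (V s)) (at s within I)"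
    and continuous_\<sigma>: "continuous_on I \<sigma>"
begin

definition W :: "real \<Rightarrow> real^3" where "W s = cross3 (E s) (V s)"

lemma deriv_W:
  assumes s: "s \<in> I"
  shows "(W has_vector_derivative \<omega> s *\<^sub>R (\<sigma> s *\<^sub>R E s - V s)) (at s within I)"
proof -
  have VV: "V s \<bullet> V s = 1" and EE: "E s \<bullet> E s = 1" and VE: "V s \<bullet> E s = 0" "E s \<bullet> V s = 0"
    using norm_V[OF s] norm_E[OF s] V_orth_E[OF s] by (simp_all add: norm_eq_1 inner_commute)
  have EW: "cross3 (E s) (W s) = - V s" and VW: "cross3 (V s) (W s) = E s"
    by (simp_all add: W_def Lagrange VV EE VE)
  have WV: "cross3 (W s) (V s) = - E s" using cross_skew[of "W s" "V s"] VW by simp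
  have bl: "bounded_bilinear cross3"
    using bilinear_cross bilinear_conv_bounded_bilinear by blast
  have "((\<lambda>s. cross3 (E s) (V s)) has_vector_derivative
      cross3 (E s) (\<omega> s *\<^sub>R W s) + cross3 (- (\<omega> s * \<sigma> s) *\<^sub>R W s) (V s)) (at s within I)"
    using bounded_bilinear.has_vector_derivative[OF bl deriv_E[OF s] deriv_V[OF s]]
    by (simp add: W_def)
  also have "cross3 (E s) (\<omega> s *\<^sub>R W s) + cross3 (- (\<omega> s * \<sigma> s) *\<^sub>R W s) (V s)
      = \<omega> s *\<^sub>R (\<sigma> s *\<^sub>R E s - V s)"
    by (simp add: cross_mult_left cross_mult_right EW WV algebra_simps)
  finally show ?thesis by (simp add: W_def[abs_def])
qed

lemma frame_eq_0:
  assumes "s \<in> I" "V s \<bullet> d = 0" "W s \<bullet> d = 0" "E s \<bullet> d = 0"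
  shows "d = 0"
  using cross3_frame_expansion[of "V s" "E s" d] assms norm_V[of s] norm_E[of s] V_orth_E[of s]
  by (simp add: W_def inner_commute)

lemma frame_norm_squared:
  assumes "s \<in> I"
  shows "d \<bullet> d = (V s \<bullet> d)\<^sup>2 + (W s \<bullet> d)\<^sup>2 + (E s \<bullet> d)\<^sup>2"
proof -
  let ?e = "(d \<bullet> V s) *\<^sub>R V s + (d \<bullet> W s) *\<^sub>R W s + (d \<bullet> E s) *\<^sub>R E s"
  have "d = ?e"
    using cross3_frame_expansion[of "V s" "E s" d] assms norm_V[of s] norm_E[of s] V_orth_E[of s]
    by (simp add: W_def)
  then have "d \<bullet> d = ?e \<bullet> d" by (rule arg_cong)
  also have "\<dots> = (V s \<bullet> d)\<^sup>2 + (W s \<bullet> d)\<^sup>2 + (E s \<bullet> d)\<^sup>2"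
    unfolding inner_add_left inner_scaleR_left inner_commute[of d] by (simp add: power2_eq_square)
  finally show ?thesis .
qed

lemma deriv_inner:
  assumes "s \<in> I"
  shows "((\<lambda>s. V s \<bullet> d) has_vector_derivative \<omega> s * (W s \<bullet> d)) (at s within I)"
    and "((\<lambda>s. E s \<bullet> d) has_vector_derivative - (\<omega> s * \<sigma> s) * (W s \<bullet> d)) (at s within I)"
    and "((\<lambda>s. W s \<bullet> d) has_vector_derivative \<omega> s * (\<sigma> s * (E s \<bullet> d) - V s \<bullet> d)) (at s within I)"
  using bounded_linear.has_vector_derivative[OF bounded_linear_inner_left deriv_V[OF assms], of d]
    bounded_linear.has_vector_derivative[OF bounded_linear_inner_left deriv_E[OF assms], of d]
    bounded_linear.has_vector_derivative[OF bounded_linear_inner_left deriv_W[OF assms], of d]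
  by (simp_all add: W_def inner_diff_left)

lemma V_slant_W_orth:
  assumes c: "\<And>s. s \<in> I \<Longrightarrow> V s \<bullet> d = c" and s: "s \<in> I"
  shows "W s \<bullet> d = 0"
  using locally_constant_has_vector_derivative[OF interval deriv_inner(1)[OF s] s, of d c] \<omega>_pos[OF s] c s
  by (auto simp: eventually_at_filter)

lemma V_slant_imp_E_slant:
  assumes c: "\<And>s. s \<in> I \<Longrightarrow> V s \<bullet> d = c"
  shows "(\<lambda>s. E s \<bullet> d) constant_on I"
  using deriv_inner(2)[of _ d] V_slant_W_orth[OF c]
  by (intro has_vector_derivative_0_constant_on[OF interval]) simp

text \<open>
  Differentiating \<open>W \<bullet> d = 0\<close> gives the ratio. The axis cannot be orthogonal to \<open>E\<close>: the ratio would
  then make it orthogonal to \<open>V\<close> too, hence to the whole frame.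
\<close>

lemma slant_ratio:
  assumes d: "norm d = 1" and s: "s \<in> I" and ev: "eventually (\<lambda>t. W t \<bullet> d = 0) (at s within I)"
    and W0: "W s \<bullet> d = 0"
  shows "\<sigma> s * (E s \<bullet> d) = V s \<bullet> d" and "E s \<bullet> d \<noteq> 0" and "(V s \<bullet> d)\<^sup>2 + (E s \<bullet> d)\<^sup>2 = 1"
proof -
  show eq: "\<sigma> s * (E s \<bullet> d) = V s \<bullet> d"
    using locally_constant_has_vector_derivative[OF interval deriv_inner(3)[OF s] s ev W0] \<omega>_pos[OF s] by simp
  show "E s \<bullet> d \<noteq> 0" using frame_eq_0[OF s _ W0] eq d by force
  show "(V s \<bullet> d)\<^sup>2 + (E s \<bullet> d)\<^sup>2 = 1"
    using frame_norm_squared[OF s, of d] d W0 by (simp add: norm_eq_1)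
qed

lemma V_slant_imp_\<sigma>_constant:
  assumes d: "norm d = 1" and c: "\<And>s. s \<in> I \<Longrightarrow> V s \<bullet> d = c"
  shows "\<sigma> constant_on I" and "c\<^sup>2 < 1"
proof -
  obtain e where e: "\<And>s. s \<in> I \<Longrightarrow> E s \<bullet> d = e"
    using V_slant_imp_E_slant[OF c] unfolding constant_on_def by auto
  have r: "\<sigma> s * e = c" "e \<noteq> 0" "c\<^sup>2 + e\<^sup>2 = 1" if s: "s \<in> I" for s
    using slant_ratio[OF d s] V_slant_W_orth[OF c] c[OF s] e[OF s] s
    by (simp_all add: eventually_at_filter)
  show "\<sigma> constant_on I" unfolding constant_on_def using r by (metis nonzero_eq_divide_eq)
  obtain s where "s \<in> I" using nondegenerate_interval_nonempty[OF interval] by blast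
  then have "c\<^sup>2 + e\<^sup>2 = 1" "e \<noteq> 0" using r by blast+
  then show "c\<^sup>2 < 1" using zero_less_power2[of e] by linarith
qed

text \<open>
  For a constant ratio the axis is explicit: the derivatives of \<open>\<sigma> V\<close> and \<open>E\<close> cancel, so
  \<open>\<sigma> V + E\<close> is a fixed vector.
\<close>

lemma \<sigma>_constant_imp_slant:
  assumes "\<sigma> constant_on I"
  obtains d c where "norm d = 1" "\<And>s. s \<in> I \<Longrightarrow> V s \<bullet> d = c"
proof -
  obtain k where k: "\<And>s. s \<in> I \<Longrightarrow> \<sigma> s = k" using assms unfolding constant_on_def by blast
  have "((\<lambda>s. k *\<^sub>R V s + E s) has_vector_derivative 0) (at s within I)" if s: "s \<in> I" for s
    using has_vector_derivative_add[OF bounded_linear.has_vector_derivative[OF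
        bounded_linear_scaleR_right deriv_V[OF s], of k] deriv_E[OF s]] k[OF s]
    by (simp add: mult.commute)
  then have "(\<lambda>s. k *\<^sub>R V s + E s) constant_on I"
    by (rule has_vector_derivative_0_constant_on[OF interval])
  then obtain d where d: "\<And>s. s \<in> I \<Longrightarrow> k *\<^sub>R V s + E s = d"
    unfolding constant_on_def by blast
  have Vd: "V s \<bullet> d = k" and "d \<noteq> 0" if s: "s \<in> I" for s
  proof -
    have "V s \<bullet> V s = 1" "E s \<bullet> E s = 1" "V s \<bullet> E s = 0"
      using norm_V[OF s] norm_E[OF s] V_orth_E[OF s] by (simp_all add: norm_eq_1)
    then have "V s \<bullet> d = k" "E s \<bullet> d = 1"
      using d[OF s, symmetric] by (simp_all add: inner_add_right inner_commute)
    then show "V s \<bullet> d = k" "d \<noteq> 0" by auto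
  qed
  moreover have "d \<noteq> 0" using calculation(2) nondegenerate_interval_nonempty[OF interval] by blast
  ultimately show ?thesis using that[of "d /\<^sub>R norm d" "k / norm d"] by (simp add: field_simps)
qed

theorem V_slant_iff_\<sigma>_constant:
  "(\<exists>d. norm d = 1 \<and> (\<lambda>s. V s \<bullet> d) constant_on I) \<longleftrightarrow> \<sigma> constant_on I"
proof
  assume "\<exists>d. norm d = 1 \<and> (\<lambda>s. V s \<bullet> d) constant_on I"
  then obtain d c where "norm d = 1" "\<And>s. s \<in> I \<Longrightarrow> V s \<bullet> d = c" unfolding constant_on_def by blast
  then show "\<sigma> constant_on I" by (rule V_slant_imp_\<sigma>_constant)
next
  assume "\<sigma> constant_on I"
  then show "\<exists>d. norm d = 1 \<and> (\<lambda>s. V s \<bullet> d) constant_on I"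
    using \<sigma>_constant_imp_slant unfolding constant_on_def by metis
qed

text \<open>
  Unlike for \<open>V\<close>, a constant inner product of \<open>E\<close> with \<open>d\<close> says nothing about \<open>W \<bullet> d\<close> where \<open>\<sigma>\<close>
  vanishes, since \<open>E\<close> is stationary there. On the relatively open set where \<open>\<sigma>\<close> does not vanish, \<open>d\<close> is
  orthogonal to \<open>W\<close>, so \<open>slant_ratio\<close> determines \<open>\<sigma>\<^sup>2\<close> from \<open>e\<close> alone. Hence \<open>\<sigma>\<close> takes at most three
  values, and a continuous function with finite range on an interval is constant.
\<close>

lemma E_slant_imp_\<sigma>_constant:
  assumes d: "norm d = 1" and e: "\<And>s. s \<in> I \<Longrightarrow> E s \<bullet> d = e"
  shows "\<sigma> constant_on I"
proof -
  have W0: "W s \<bullet> d = 0" if s: "s \<in> I" and "\<sigma> s \<noteq> 0" for s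
    using locally_constant_has_vector_derivative[OF interval deriv_inner(2)[OF s] s, of d e] \<omega>_pos[OF s] e that
    by (auto simp: eventually_at_filter)
  have "\<sigma> s \<in> {0, sqrt ((1 - e\<^sup>2) / e\<^sup>2), - sqrt ((1 - e\<^sup>2) / e\<^sup>2)}" if s: "s \<in> I" for s
  proof (cases "\<sigma> s = 0")
    case False
    have "(\<sigma> \<longlongrightarrow> \<sigma> s) (at s within I)" using continuous_\<sigma> s by (simp add: continuous_on_def)
    then have "eventually (\<lambda>t. \<sigma> t \<noteq> 0) (at s within I)" using False tendsto_imp_eventually_ne by blast
    then have "eventually (\<lambda>t. W t \<bullet> d = 0) (at s within I)"
      unfolding eventually_at_filter by eventually_elim (use W0 in auto)
    note r = slant_ratio[OF d s this W0[OF s False]]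
    have "(\<sigma> s)\<^sup>2 * e\<^sup>2 = 1 - e\<^sup>2" "e \<noteq> 0"
      using r e[OF s] by (auto simp flip: power_mult_distrib)
    then have "(\<sigma> s)\<^sup>2 = (1 - e\<^sup>2) / e\<^sup>2" by (simp add: field_simps)
    then have "\<bar>\<sigma> s\<bar> = sqrt ((1 - e\<^sup>2) / e\<^sup>2)" by (metis real_sqrt_abs)
    then show ?thesis by (auto simp: abs_if split: if_splits)
  qed simp
  then have "\<sigma> ` I \<subseteq> {0, sqrt ((1 - e\<^sup>2) / e\<^sup>2), - sqrt ((1 - e\<^sup>2) / e\<^sup>2)}" by blast
  then have "finite (\<sigma> ` I)" by (rule finite_subset) simp
  then show ?thesis
    using continuous_finite_range_constant[OF is_interval_connected continuous_\<sigma>] interval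
    unfolding nondegenerate_interval_def by blast
qed

theorem E_slant_iff_\<sigma>_constant:
  "(\<exists>d. norm d = 1 \<and> (\<lambda>s. E s \<bullet> d) constant_on I) \<longleftrightarrow> \<sigma> constant_on I"
proof
  assume "\<exists>d. norm d = 1 \<and> (\<lambda>s. E s \<bullet> d) constant_on I"
  then obtain d e where "norm d = 1" "\<And>s. s \<in> I \<Longrightarrow> E s \<bullet> d = e" unfolding constant_on_def by blast
  then show "\<sigma> constant_on I" by (rule E_slant_imp_\<sigma>_constant)
next
  assume "\<sigma> constant_on I"
  then show "\<exists>d. norm d = 1 \<and> (\<lambda>s. E s \<bullet> d) constant_on I"
    using \<sigma>_constant_imp_slant V_slant_imp_E_slant by metis
qed

text \<open>
  Plane sections of the unit sphere: the condition \<open>V \<bullet> d = c\<close> describes the circle with centre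
  \<open>c *\<^sub>R d\<close> and radius \<open>sqrt (1 - c\<^sup>2)\<close>. The radius is positive because \<open>V\<close>, having nonzero
  derivative, cannot stay at a pole.
\<close>

theorem V_slant_iff_circle:
  "(\<exists>d. norm d = 1 \<and> (\<lambda>s. V s \<bullet> d) constant_on I) \<longleftrightarrow>
    (\<exists>C. circle C \<and> C \<subseteq> sphere 0 1 \<and> V ` I \<subseteq> C)"
proof
  assume "\<exists>d. norm d = 1 \<and> (\<lambda>s. V s \<bullet> d) constant_on I"
  then obtain d c where d: "norm d = 1" and c: "\<And>s. s \<in> I \<Longrightarrow> V s \<bullet> d = c"
    unfolding constant_on_def by blast
  define r where "r = sqrt (1 - c\<^sup>2)"
  define C where "C = {x. dist (c *\<^sub>R d) x = r \<and> (x - c *\<^sub>R d) \<bullet> d = 0}"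
  have c1: "c\<^sup>2 < 1" using V_slant_imp_\<sigma>_constant(2)[OF d c] .
  have dd: "d \<bullet> d = 1" using d by (simp add: norm_eq_1)
  have "x \<in> C \<longleftrightarrow> norm x = 1 \<and> x \<bullet> d = c" for x
  proof -
    have "(dist (c *\<^sub>R d) x)\<^sup>2 = x \<bullet> x - c\<^sup>2" if "x \<bullet> d = c"
      unfolding dist_norm power2_norm_eq_inner
      using that dd by (simp add: inner_diff_left inner_diff_right inner_commute power2_eq_square)
    moreover have "dist (c *\<^sub>R d) x = r \<longleftrightarrow> (dist (c *\<^sub>R d) x)\<^sup>2 = 1 - c\<^sup>2"
      using c1 unfolding r_def by (metis abs_of_nonneg diff_ge_0_iff_ge less_imp_le real_sqrt_abs
          real_sqrt_pow2 zero_le_dist)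
    ultimately show ?thesis
      using dd unfolding C_def norm_eq_1 by (auto simp: inner_diff_left)
  qed
  then have "C \<subseteq> sphere 0 1" "V ` I \<subseteq> C" using c norm_V by auto
  moreover have "r > 0" using c1 by (simp add: r_def)
  then have "circle C" using d unfolding circle_def C_def by blast
  ultimately show "\<exists>C. circle C \<and> C \<subseteq> sphere 0 1 \<and> V ` I \<subseteq> C" by blast
next
  assume "\<exists>C. circle C \<and> C \<subseteq> sphere 0 1 \<and> V ` I \<subseteq> C"
  then obtain p n where n: "norm n = 1" "\<And>s. s \<in> I \<Longrightarrow> (V s - p) \<bullet> n = 0"
    unfolding circle_def by blast
  then have "V s \<bullet> n = p \<bullet> n" if "s \<in> I" for s using that by (auto simp: inner_diff_left)
  then show "\<exists>d. norm d = 1 \<and> (\<lambda>s. V s \<bullet> d) constant_on I"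
    using n(1) unfolding constant_on_def by blast
qed

end

text \<open>
  The angle formulation: by the Cauchy-Schwarz inequality every constant that occurs is a cosine.
\<close>

lemma unit_slant_iff_cos:
  fixes X :: "real \<Rightarrow> 'a::real_inner"
  assumes "I \<noteq> {}" and unit: "\<And>s. s \<in> I \<Longrightarrow> norm (X s) = 1"
  shows "(\<exists>d \<theta>. norm d = 1 \<and> (\<forall>s\<in>I. X s \<bullet> d = cos \<theta>)) \<longleftrightarrow>
    (\<exists>d. norm d = 1 \<and> (\<lambda>s. X s \<bullet> d) constant_on I)"
proof
  assume "\<exists>d. norm d = 1 \<and> (\<lambda>s. X s \<bullet> d) constant_on I"
  then obtain d c where d: "norm d = 1" and c: "\<And>s. s \<in> I \<Longrightarrow> X s \<bullet> d = c"
    unfolding constant_on_def by blast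
  obtain s where "s \<in> I" using assms(1) by blast
  then have "\<bar>c\<bar> \<le> 1" using Cauchy_Schwarz_ineq2[of "X s" d] c unit d by simp
  then have "cos (arccos c) = c" by (simp add: cos_arccos_abs)
  then show "\<exists>d \<theta>. norm d = 1 \<and> (\<forall>s\<in>I. X s \<bullet> d = cos \<theta>)" using d c by metis
qed (auto simp: constant_on_def)

section \<open>The frame of the normal indicatrix\<close>

locale darboux_curve =
  fixes M :: "(real^3) set" and N :: "real^3 \<Rightarrow> real^3"
    and I :: "real set" and \<gamma> :: "real \<Rightarrow> real^3"
  assumes surface: "oriented_surface M N"
    and interval: "nondegenerate_interval I"
    and curve: "unit_speed_curve_on M I \<gamma>"
    and nonzero: "\<forall>s\<in>I. (geodesic_curvature N I \<gamma> s, geodesic_torsion N I \<gamma> s) \<noteq> (0, 0)"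
begin

abbreviation "T \<equiv> darboux_T I \<gamma>"
abbreviation "U \<equiv> darboux_U N \<gamma>"
abbreviation "V \<equiv> darboux_V N I \<gamma>"
abbreviation "\<kappa>g \<equiv> geodesic_curvature N I \<gamma>"
abbreviation "\<kappa>n \<equiv> normal_curvature N I \<gamma>"
abbreviation "\<tau>g \<equiv> geodesic_torsion N I \<gamma>"
abbreviation "D \<equiv> rectifying_darboux N I \<gamma>"
abbreviation "\<sigma> \<equiv> sigma_v N I \<gamma>"

text \<open>
  The length of \<open>V'\<close>, which is also the length of the rectifying Darboux vector.
\<close>

definition \<omega> :: "real \<Rightarrow> real" where "\<omega> s = sqrt ((\<kappa>g s)\<^sup>2 + (\<tau>g s)\<^sup>2)"

text \<open>
  The Wronskian of \<open>\<kappa>g\<close> and \<open>\<tau>g\<close>; divided by \<open>\<omega>\<^sup>2\<close> it is, up to sign, the rate at which \<open>D\<close> turns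
  relative to \<open>T\<close> and \<open>U\<close>.
\<close>

definition J :: "real \<Rightarrow> real" where
  "J s = curve_deriv I \<tau>g s * \<kappa>g s - curve_deriv I \<kappa>g s * \<tau>g s"

lemma frame_inner:
  assumes s: "s \<in> I"
  shows "T s \<bullet> T s = 1" "U s \<bullet> U s = 1" "V s \<bullet> V s = 1"
    "T s \<bullet> U s = 0" "U s \<bullet> T s = 0" "T s \<bullet> V s = 0" "V s \<bullet> T s = 0" "U s \<bullet> V s = 0" "V s \<bullet> U s = 0"
proof -
  show T: "T s \<bullet> T s = 1" and U: "U s \<bullet> U s = 1"
    using curve surface s
    by (auto simp: darboux_T_def darboux_U_def unit_speed_curve_on_def
        oriented_surface_def dot_square_norm image_subset_iff)
  show TU: "T s \<bullet> U s = 0" by (rule velocity_orthogonal_normal[OF surface interval curve s])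
  then show "U s \<bullet> T s = 0" by (simp add: inner_commute)
  then show "V s \<bullet> V s = 1" by (simp add: darboux_V_def dot_cross T U)
  show "T s \<bullet> V s = 0" "V s \<bullet> T s = 0" "U s \<bullet> V s = 0" "V s \<bullet> U s = 0"
    by (simp_all add: darboux_V_def dot_cross_self)
qed

lemma frame_cross:
  assumes s: "s \<in> I"
  shows "cross3 (U s) (T s) = V s" "cross3 (T s) (U s) = - V s"
    "cross3 (V s) (U s) = T s" "cross3 (U s) (V s) = - T s"
    "cross3 (T s) (V s) = U s" "cross3 (V s) (T s) = - U s"
proof -
  show V: "cross3 (U s) (T s) = V s" by (simp add: darboux_V_def)
  then show "cross3 (T s) (U s) = - V s" by (simp add: cross_skew[of "T s"])
  show UV: "cross3 (U s) (V s) = - T s" and TV: "cross3 (T s) (V s) = U s"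
    by (simp_all add: darboux_V_def Lagrange frame_inner[OF s])
  show "cross3 (V s) (U s) = T s" "cross3 (V s) (T s) = - U s"
    using UV TV cross_skew[of "V s"] by simp_all
qed

lemmas darboux_derivs = darboux_equations[OF surface interval curve]

lemma smooth_T: "smooth_on I T"
  using smooth_on_curve_deriv[OF _ interval] curve
  unfolding unit_speed_curve_on_def darboux_T_def[abs_def] by blast

lemma smooth_U: "smooth_on I U"
  using smooth_on_compose[of I \<gamma> M N] curve surface
  unfolding unit_speed_curve_on_def oriented_surface_def darboux_U_def[abs_def] by blast

lemma smooth_V: "smooth_on I V"
proof -
  have "bounded_bilinear cross3"
    using bilinear_cross bilinear_conv_bounded_bilinear by blast
  then show ?thesis
    unfolding darboux_V_def[abs_def] by (rule smooth_on_bounded_bilinear[OF _ smooth_U smooth_T])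
qed

lemma smooth_\<kappa>g: "smooth_on I \<kappa>g"
  unfolding geodesic_curvature_def[abs_def]
  by (intro smooth_on_bounded_bilinear[OF bounded_bilinear_inner] smooth_on_curve_deriv
      smooth_T smooth_V interval)

lemma smooth_\<kappa>n: "smooth_on I \<kappa>n"
  unfolding normal_curvature_def[abs_def]
  by (intro smooth_on_bounded_bilinear[OF bounded_bilinear_inner] smooth_on_curve_deriv
      smooth_T smooth_U interval)

lemma smooth_\<tau>g: "smooth_on I \<tau>g"
  unfolding geodesic_torsion_def[abs_def]
  by (intro smooth_on_bounded_bilinear[OF bounded_bilinear_inner] smooth_on_curve_deriv
      smooth_V smooth_U interval)

lemma smooth_D: "smooth_on I D"
  unfolding rectifying_darboux_def[abs_def]
  by (intro smooth_on_add smooth_on_bounded_bilinear[OF bounded_bilinear_scaleR]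
      smooth_\<tau>g smooth_\<kappa>g smooth_T smooth_U)

lemma \<omega>_squared: "(\<omega> s)\<^sup>2 = (\<kappa>g s)\<^sup>2 + (\<tau>g s)\<^sup>2"
  by (simp add: \<omega>_def)

lemma \<omega>_pos: "s \<in> I \<Longrightarrow> \<omega> s > 0"
  using nonzero by (auto simp: \<omega>_def sum_power2_gt_zero_iff)

lemma norm_D:
  assumes s: "s \<in> I"
  shows "norm (D s) = \<omega> s"
  unfolding norm_eq_sqrt_inner rectifying_darboux_def \<omega>_def
  by (simp add: inner_add_left inner_add_right frame_inner[OF s] power2_eq_square add.commute)

lemma \<sigma>_eq:
  assumes s: "s \<in> I"
  shows "\<sigma> s = (J s - \<kappa>n s * (\<omega> s)\<^sup>2) / (\<omega> s) ^ 3"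
proof -
  have "((\<omega> s)\<^sup>2) powr (3 / 2) = \<omega> s powr 3"
    using \<omega>_pos[OF s] by (simp add: powr_powr flip: powr_numeral)
  also have "\<dots> = (\<omega> s) ^ 3" using \<omega>_pos[OF s] by simp
  finally show ?thesis by (simp add: sigma_v_def Let_def J_def \<omega>_squared)
qed

lemma continuous_\<sigma>: "continuous_on I \<sigma>"
proof -
  have "continuous_on I (\<lambda>s. (J s - \<kappa>n s * (\<omega> s)\<^sup>2) / (\<omega> s) ^ 3)"
    unfolding J_def \<omega>_def
    by (intro continuous_intros smooth_on_imp_continuous_on smooth_on_curve_deriv
        smooth_\<kappa>g smooth_\<tau>g smooth_\<kappa>n interval)
       (use \<omega>_pos in \<open>force simp: \<omega>_def\<close>)
  then show ?thesis by (simp add: \<sigma>_eq cong: continuous_on_cong)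
qed

text \<open>
  This explains the name of \<open>D\<close>: \<open>V\<close> rotates about \<open>D\<close>, and \<open>D\<close> is orthogonal to \<open>V\<close>.
\<close>

lemma deriv_V:
  assumes s: "s \<in> I"
  shows "(V has_vector_derivative cross3 (D s) (V s)) (at s within I)"
  using darboux_derivs(2)[OF s]
  by (simp add: rectifying_darboux_def cross_add_left cross_mult_left frame_cross[OF s] algebra_simps)

lemma curve_deriv_D:
  assumes s: "s \<in> I"
  shows "curve_deriv I D s = (curve_deriv I \<tau>g s - \<kappa>n s * \<kappa>g s) *\<^sub>R T s
    + (curve_deriv I \<kappa>g s + \<kappa>n s * \<tau>g s) *\<^sub>R U s"
proof (rule vector_derivative_within[OF at_within_interval_neq_bot[OF interval s]])
  have "(D has_vector_derivative
      (\<tau>g s *\<^sub>R (\<kappa>g s *\<^sub>R V s + \<kappa>n s *\<^sub>R U s) + curve_deriv I \<tau>g s *\<^sub>R T s) +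
      (\<kappa>g s *\<^sub>R (- \<kappa>n s *\<^sub>R T s - \<tau>g s *\<^sub>R V s) + curve_deriv I \<kappa>g s *\<^sub>R U s)) (at s within I)"
    unfolding rectifying_darboux_def[abs_def]
    by (intro has_vector_derivative_add darboux_derivs s
        bounded_bilinear.has_vector_derivative[OF bounded_bilinear_scaleR]
        smooth_on_has_curve_deriv smooth_\<tau>g smooth_\<kappa>g)
  then show "(D has_vector_derivative (curve_deriv I \<tau>g s - \<kappa>n s * \<kappa>g s) *\<^sub>R T s
    + (curve_deriv I \<kappa>g s + \<kappa>n s * \<tau>g s) *\<^sub>R U s) (at s within I)"
    by (simp add: algebra_simps)
qed

lemma \<omega>_cubed_\<sigma>:
  assumes s: "s \<in> I"
  shows "(\<omega> s) ^ 3 * \<sigma> s = \<kappa>g s * (curve_deriv I \<tau>g s - \<kappa>n s * \<kappa>g s)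
    - \<tau>g s * (curve_deriv I \<kappa>g s + \<kappa>n s * \<tau>g s)"
proof -
  have "(\<omega> s) ^ 3 * \<sigma> s = J s - \<kappa>n s * (\<omega> s)\<^sup>2"
    using \<omega>_pos[OF s] by (simp add: \<sigma>_eq[OF s])
  then show ?thesis unfolding \<omega>_squared J_def by (simp add: algebra_simps power2_eq_square)
qed

text \<open>
  The identity in which \<open>\<sigma>\<close> enters: it yields both the derivative of the normalized field \<open>D\<close> and the
  curvature and torsion of the integral curves of \<open>D\<close>.
\<close>

lemma cross_D_curve_deriv_D:
  assumes s: "s \<in> I"
  shows "cross3 (D s) (curve_deriv I D s) = ((\<omega> s) ^ 3 * \<sigma> s) *\<^sub>R V s"
  unfolding curve_deriv_D[OF s] \<omega>_cubed_\<sigma>[OF s] rectifying_darboux_def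
  by (simp add: cross_add_left cross_add_right cross_mult_left cross_mult_right frame_cross[OF s])
     (simp add: algebra_simps)

text \<open>
  The derivative of a normalized field is the component of its derivative orthogonal to the field,
  \<open>- D \<times> (D \<times> D')\<close> up to the factor \<open>1 / \<omega> ^ 3\<close>, and \<open>D \<times> D'\<close> is known.
\<close>

lemma deriv_E:
  assumes s: "s \<in> I"
  shows "((\<lambda>s. D s /\<^sub>R norm (D s)) has_vector_derivative
    - (\<omega> s * \<sigma> s) *\<^sub>R cross3 (D s /\<^sub>R norm (D s)) (V s)) (at s within I)"
proof -
  define D' where "D' = curve_deriv I D s"
  have \<omega>: "\<omega> s > 0" by (rule \<omega>_pos[OF s])
  have D': "(D has_vector_derivative D') (at s within I)"
    unfolding D'_def by (rule smooth_on_has_curve_deriv[OF smooth_D s])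
  have DD: "D s \<bullet> D s = (\<omega> s)\<^sup>2" using norm_D[OF s] by (simp flip: power2_norm_eq_inner)
  have D0: "D s \<noteq> 0" using \<omega> norm_D[OF s] by auto
  have "((\<lambda>t. norm (D t)) has_derivative (\<lambda>h. (h *\<^sub>R D') \<bullet> sgn (D s))) (at s within I)"
    using has_derivative_compose[OF D'[unfolded has_vector_derivative_def] has_derivative_norm[OF D0]] .
  moreover have "(\<lambda>h. (h *\<^sub>R D') \<bullet> sgn (D s)) = (*) ((D s \<bullet> D') / \<omega> s)"
    by (rule ext) (simp add: sgn_div_norm norm_D[OF s] inner_commute divide_inverse ac_simps)
  ultimately have norm': "((\<lambda>t. norm (D t)) has_field_derivative (D s \<bullet> D') / \<omega> s) (at s within I)"
    by (simp add: has_field_derivative_def)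
  have "((\<lambda>t. D t /\<^sub>R norm (D t)) has_vector_derivative
      inverse (norm (D s)) *\<^sub>R D' +
      (- (inverse (norm (D s)) * ((D s \<bullet> D') / \<omega> s) * inverse (norm (D s)))) *\<^sub>R D s) (at s within I)"
    using \<omega> norm_D[OF s]
    by (intro has_vector_derivative_scaleR DERIV_inverse' norm' D') auto
  also have "inverse (norm (D s)) *\<^sub>R D' +
      (- (inverse (norm (D s)) * ((D s \<bullet> D') / \<omega> s) * inverse (norm (D s)))) *\<^sub>R D s
      = inverse (\<omega> s) *\<^sub>R D' - ((D s \<bullet> D') / (\<omega> s) ^ 3) *\<^sub>R D s"
    by (simp add: norm_D[OF s] inverse_eq_divide power3_eq_cube)
  also have "inverse (\<omega> s) *\<^sub>R D' - ((D s \<bullet> D') / (\<omega> s) ^ 3) *\<^sub>R D s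
      = inverse ((\<omega> s) ^ 3) *\<^sub>R ((D s \<bullet> D s) *\<^sub>R D' - (D s \<bullet> D') *\<^sub>R D s)"
  proof -
    have "inverse ((\<omega> s) ^ 3) * (\<omega> s)\<^sup>2 = inverse (\<omega> s)"
      using \<omega> by (simp add: field_simps power2_eq_square power3_eq_cube)
    then show ?thesis by (simp add: DD scaleR_diff_right divide_inverse mult.commute)
  qed
  also have "(D s \<bullet> D s) *\<^sub>R D' - (D s \<bullet> D') *\<^sub>R D s = - cross3 (D s) (cross3 (D s) D')"
    by (simp add: Lagrange)
  also have "\<dots> = - ((\<omega> s) ^ 3 * \<sigma> s) *\<^sub>R cross3 (D s) (V s)"
    by (simp add: D'_def cross_D_curve_deriv_D[OF s] cross_mult_right)
  also have "inverse ((\<omega> s) ^ 3) *\<^sub>R (- ((\<omega> s) ^ 3 * \<sigma> s) *\<^sub>R cross3 (D s) (V s))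
      = - (\<omega> s * \<sigma> s) *\<^sub>R cross3 (D s /\<^sub>R norm (D s)) (V s)"
  proof -
    have "inverse ((\<omega> s) ^ 3) * ((\<omega> s) ^ 3 * \<sigma> s) = \<sigma> s" "\<omega> s * \<sigma> s * inverse (\<omega> s) = \<sigma> s"
      using \<omega> by simp_all
    then show ?thesis by (auto simp: norm_D[OF s] cross_mult_left)
  qed
  finally show ?thesis .
qed

sublocale indicatrix: moving_frame I V "\<lambda>s. D s /\<^sub>R norm (D s)" \<omega> \<sigma>
proof
  fix s assume s: "s \<in> I"
  show "norm (V s) = 1" using frame_inner[OF s] by (simp add: norm_eq_1)
  show "norm (D s /\<^sub>R norm (D s)) = 1" using \<omega>_pos[OF s] norm_D[OF s] by simp
  show "V s \<bullet> (D s /\<^sub>R norm (D s)) = 0"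
    by (simp add: rectifying_darboux_def inner_add_right frame_inner[OF s])
  show "\<omega> s > 0" by (rule \<omega>_pos[OF s])
  show "(V has_vector_derivative \<omega> s *\<^sub>R cross3 (D s /\<^sub>R norm (D s)) (V s)) (at s within I)"
    using deriv_V[OF s] \<omega>_pos[OF s] by (simp add: norm_D[OF s] cross_mult_left)
  show "((\<lambda>s. D s /\<^sub>R norm (D s)) has_vector_derivative
    - (\<omega> s * \<sigma> s) *\<^sub>R cross3 (D s /\<^sub>R norm (D s)) (V s)) (at s within I)" by (rule deriv_E[OF s])
qed (rule interval, rule continuous_\<sigma>)

section \<open>Integral curves\<close>

lemma integral_curve_exists: "smooth_on I X \<Longrightarrow> \<exists>\<beta>. integral_curve I X \<beta>"
  using has_antiderivative_on_interval[of I X] smooth_on_imp_continuous_on interval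
  unfolding integral_curve_def nondegenerate_interval_def by metis

lemma curve_deriv_integral_curve:
  "integral_curve I X \<beta> \<Longrightarrow> s \<in> I \<Longrightarrow> curve_deriv I \<beta> s = X s"
  using vector_derivative_within[OF at_within_interval_neq_bot[OF interval]] unfolding integral_curve_def by blast

text \<open>
  An integral curve, and therefore each of its iterated derivatives, is determined only on \<open>I\<close>;
  derivatives within \<open>I\<close> do not see the values elsewhere.
\<close>

lemma curve_deriv_cong:
  assumes "s \<in> I" "\<And>t. t \<in> I \<Longrightarrow> f t = g t"
  shows "curve_deriv I f s = curve_deriv I g s"
  by (rule vector_derivative_cong_eq)
     (use assms in \<open>auto simp: eventually_at_filter\<close>)

lemma slant_iff: "relatively_normal_slant_helix N I \<gamma> \<longleftrightarrow>
    (\<exists>d. norm d = 1 \<and> (\<lambda>s. V s \<bullet> d) constant_on I)"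
  unfolding relatively_normal_slant_helix_def by (rule unit_slant_iff_cos[OF nondegenerate_interval_nonempty[OF interval] indicatrix.norm_V])

lemma general_helix_V_direction_curve:
  assumes "V_direction_curve N I \<gamma> \<beta>"
  shows "general_helix I \<beta> \<longleftrightarrow> relatively_normal_slant_helix N I \<gamma>"
proof -
  have "unit_tangent I \<beta> s = V s" if "s \<in> I" for s
    using curve_deriv_integral_curve[OF assms[unfolded V_direction_curve_def] that] indicatrix.norm_V[OF that]
    by (simp add: unit_tangent_def)
  then show ?thesis by (simp add: general_helix_def relatively_normal_slant_helix_def)
qed

text \<open>
  The integral curves of \<open>D\<close> have speed \<open>\<omega>\<close>, and their first two derivatives are orthogonal to \<open>V\<close>. The
  numerator of the torsion contains \<open>V \<bullet> D''\<close>; since \<open>V \<bullet> D' = 0\<close> identically, this is \<open>- V' \<bullet> D'\<close>,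
  which is again a triple product of \<open>D\<close>, \<open>V\<close>, \<open>D'\<close>. So the torsion is 1 wherever it is defined, and
  0, by division by zero, where \<open>\<sigma>\<close> vanishes.
\<close>

lemma curvature_torsion_Dr_integral_curve:
  assumes \<beta>: "Dr_integral_curve N I \<gamma> \<beta>" and s: "s \<in> I"
  shows "curvature I \<beta> s = \<bar>\<sigma> s\<bar>" "torsion I \<beta> s = (if \<sigma> s = 0 then 0 else 1)"
proof -
  let ?D' = "curve_deriv I D" and ?D'' = "curve_deriv I (curve_deriv I D)"
  have \<omega>: "\<omega> s > 0" by (rule \<omega>_pos[OF s])
  have c1: "curve_deriv I \<beta> t = D t" if "t \<in> I" for t
    using curve_deriv_integral_curve[OF \<beta>[unfolded Dr_integral_curve_def] that] .
  have c2: "curve_deriv I (curve_deriv I \<beta>) t = ?D' t" if "t \<in> I" for t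
    by (rule curve_deriv_cong[OF that c1])
  have c3: "curve_deriv I (curve_deriv I (curve_deriv I \<beta>)) s = ?D'' s"
    by (rule curve_deriv_cong[OF s c2])
  note cross = cross_D_curve_deriv_D[OF s]
  show "curvature I \<beta> s = \<bar>\<sigma> s\<bar>"
    using \<omega> indicatrix.norm_V[OF s]
    by (simp add: curvature_def Let_def c1[OF s] c2[OF s] cross norm_D[OF s] abs_mult)
  \<comment> \<open>Differentiate \<open>V \<bullet> D' = 0\<close>.\<close>
  have "V s \<bullet> ?D'' s + cross3 (D s) (V s) \<bullet> ?D' s = 0"
  proof (rule locally_constant_has_vector_derivative[OF interval _ s])
    show "((\<lambda>t. V t \<bullet> ?D' t) has_vector_derivative V s \<bullet> ?D'' s + cross3 (D s) (V s) \<bullet> ?D' s) (at s within I)"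
      by (intro bounded_bilinear.has_vector_derivative[OF bounded_bilinear_inner] deriv_V s
          smooth_on_has_curve_deriv smooth_on_curve_deriv smooth_D interval)
    have "V t \<bullet> ?D' t = 0" if "t \<in> I" for t
      by (simp add: curve_deriv_D[OF that] inner_add_right frame_inner[OF that])
    then show "eventually (\<lambda>t. V t \<bullet> ?D' t = 0) (at s within I)" "V s \<bullet> ?D' s = 0"
      using s by (auto simp: eventually_at_filter)
  qed
  moreover have "cross3 (D s) (V s) \<bullet> ?D' s = - (cross3 (D s) (?D' s) \<bullet> V s)"
    by (simp add: cross3_simps)
  ultimately have "V s \<bullet> ?D'' s = (\<omega> s) ^ 3 * \<sigma> s"
    by (simp add: cross frame_inner[OF s])
  then show "torsion I \<beta> s = (if \<sigma> s = 0 then 0 else 1)"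
    using \<omega> indicatrix.norm_V[OF s]
    by (simp add: torsion_def Let_def c1[OF s] c2[OF s] c3 cross power_mult_distrib abs_mult power2_eq_square)
qed

text \<open>
  The curvature is \<open>\<bar>\<sigma>\<bar>\<close>, and by continuity \<open>\<sigma>\<close> cannot change sign while its absolute value is
  constant.
\<close>

lemma circular_helix_Dr_integral_curve:
  assumes \<beta>: "Dr_integral_curve N I \<gamma> \<beta>"
  shows "circular_helix I \<beta> \<longleftrightarrow> \<sigma> constant_on I"
proof
  assume "circular_helix I \<beta>"
  then obtain k where "\<And>s. s \<in> I \<Longrightarrow> \<bar>\<sigma> s\<bar> = k"
    using curvature_torsion_Dr_integral_curve(1)[OF \<beta>]
    unfolding circular_helix_def constant_on_def by metis
  then have "\<sigma> ` I \<subseteq> {k, - k}" by force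
  then have "finite (\<sigma> ` I)" by (rule finite_subset) simp
  then show "\<sigma> constant_on I"
    using continuous_finite_range_constant[OF is_interval_connected continuous_\<sigma>] interval
    unfolding nondegenerate_interval_def by blast
next
  assume "\<sigma> constant_on I"
  then obtain k where "\<And>s. s \<in> I \<Longrightarrow> \<sigma> s = k" unfolding constant_on_def by blast
  then have "curvature I \<beta> s = \<bar>k\<bar>" "torsion I \<beta> s = (if k = 0 then 0 else 1)" if "s \<in> I" for s
    using curvature_torsion_Dr_integral_curve[OF \<beta> that] that by simp_all
  then show "circular_helix I \<beta>" unfolding circular_helix_def constant_on_def by blast
qed

end

theorem theorem5:
  fixes M :: "(real^3) set" and N :: "real^3 \<Rightarrow> real^3"
    and I :: "real set" and \<gamma> :: "real \<Rightarrow> real^3"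
  assumes surface: "oriented_surface M N"
    and interval: "nondegenerate_interval I"
    and curve: "unit_speed_curve_on M I \<gamma>"
    and nonzero: "\<forall>s\<in>I. (geodesic_curvature N I \<gamma> s, geodesic_torsion N I \<gamma> s) \<noteq> (0, 0)"
  shows
    "(relatively_normal_slant_helix N I \<gamma> \<longleftrightarrow>
        (\<exists>C. circle C \<and> C \<subseteq> sphere 0 1 \<and> darboux_V N I \<gamma> ` I \<subseteq> C)) \<and>
     (relatively_normal_slant_helix N I \<gamma> \<longleftrightarrow>
        sigma_v N I \<gamma> constant_on I) \<and>
     (relatively_normal_slant_helix N I \<gamma> \<longleftrightarrow>
        (\<exists>d. norm d = 1 \<and>
          (\<lambda>s. d \<bullet> (rectifying_darboux N I \<gamma> s /\<^sub>R norm (rectifying_darboux N I \<gamma> s)))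
            constant_on I)) \<and>
     (relatively_normal_slant_helix N I \<gamma> \<longleftrightarrow>
        (\<exists>\<beta>. V_direction_curve N I \<gamma> \<beta>) \<and>
        (\<forall>\<beta>. V_direction_curve N I \<gamma> \<beta> \<longrightarrow> general_helix I \<beta>)) \<and>
     (relatively_normal_slant_helix N I \<gamma> \<longleftrightarrow>
        (\<exists>\<beta>. Dr_integral_curve N I \<gamma> \<beta>) \<and>
        (\<forall>\<beta>. Dr_integral_curve N I \<gamma> \<beta> \<longrightarrow> circular_helix I \<beta>))"
proof -
  interpret darboux_curve M N I \<gamma> by unfold_locales (fact assms)+
  have i: "relatively_normal_slant_helix N I \<gamma> \<longleftrightarrow> \<sigma> constant_on I"
    using slant_iff indicatrix.V_slant_iff_\<sigma>_constant by simp
  show ?thesis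
  proof (intro conjI)
    show "relatively_normal_slant_helix N I \<gamma> \<longleftrightarrow>
        (\<exists>C. circle C \<and> C \<subseteq> sphere 0 1 \<and> darboux_V N I \<gamma> ` I \<subseteq> C)"
      using slant_iff indicatrix.V_slant_iff_circle by simp
    show "relatively_normal_slant_helix N I \<gamma> \<longleftrightarrow> sigma_v N I \<gamma> constant_on I" by (rule i)
    show "relatively_normal_slant_helix N I \<gamma> \<longleftrightarrow>
        (\<exists>d. norm d = 1 \<and>
          (\<lambda>s. d \<bullet> (rectifying_darboux N I \<gamma> s /\<^sub>R norm (rectifying_darboux N I \<gamma> s)))
            constant_on I)"
      unfolding i indicatrix.E_slant_iff_\<sigma>_constant[symmetric] by (simp only: inner_commute)
    show "relatively_normal_slant_helix N I \<gamma> \<longleftrightarrow>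
        (\<exists>\<beta>. V_direction_curve N I \<gamma> \<beta>) \<and>
        (\<forall>\<beta>. V_direction_curve N I \<gamma> \<beta> \<longrightarrow> general_helix I \<beta>)"
      using general_helix_V_direction_curve integral_curve_exists[OF smooth_V]
      unfolding V_direction_curve_def by blast
    show "relatively_normal_slant_helix N I \<gamma> \<longleftrightarrow>
        (\<exists>\<beta>. Dr_integral_curve N I \<gamma> \<beta>) \<and>
        (\<forall>\<beta>. Dr_integral_curve N I \<gamma> \<beta> \<longrightarrow> circular_helix I \<beta>)"
      using circular_helix_Dr_integral_curve integral_curve_exists[OF smooth_D] i
      unfolding Dr_integral_curve_def by blast
  qed
qed

end
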